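(* Let $1\le r\le s$ and let $A\in\mathbb{C}_r^{n\times n}$, $B\in\mathbb{C}_s^{n\times n}$ be normal matrices whose nonzero eigenvalues, listed with multiplicity, are $\lambda_1,\dots,\lambda_r$ and $\widehat\lambda_1,\dots,\widehat\lambda_s$, respectively. Put $\widehat F_{r,s}:=\sum_{j=1}^r|\lambda_j|^2+\sum_{j=1}^s|\widehat\lambda_j|^2$. Then $$\big\||A|-|B|\big\|_F\ge\min_{\substack{1\le k\le r,\\ (i_1,\dots,i_k)\in S_k([s]),\ (j_1,\dots,j_k)\in S_k([r])}}\sqrt{\frac{\widehat F_{r,s}-2\sum_{t=1}^k|\widehat\lambda_{i_t}||\lambda_{j_t}|}{\widehat F_{r,s}-2\sum_{t=1}^k\Re\big(\widehat\lambda_{i_t}\overline{\lambda_{j_t}}\big)}}\;\|A-B\|_F .$$ Moreover the coefficient of $\|A-B\|_F$ is optimal: for given $n\ge s$ and given nonzero $\lambda_1,\dots,\lambda_r$, $\widehat\lambda_1,\dots,\widehat\lambda_s$ for which there is at least one pair $A\neq B$ of $n\times n$ normal matrices with these nonzero eigenvalues, it cannot be replaced by any larger number so that the inequality still holds for all such pairs $A,B$.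
   Context: $\mathbb{C}^{n\times n}_r$ denotes the set of complex $n\times n$ matrices of rank $r$; $\|\cdot\|_F$ is the Frobenius norm; $|A|:=(A^*A)^{1/2}$; $[r]=\{1,\dots,r\}$; $S_k([r])$ is the set of ordered arrangements $(j_1,\dots,j_k)$ of $k$ distinct elements of $[r]$; $\Re$ denotes real part. A quotient of the form $0/0$ in the minimum is read as $1$. *)

theory Defs
  imports
    "Jordan_Normal_Form.Schur_Decomposition"
    "Jordan_Normal_Form.DL_Rank"
begin

definition frob_norm :: "complex mat \<Rightarrow> real" where
  "frob_norm A = sqrt (\<Sum>i<dim_row A. \<Sum>j<dim_col A. (cmod (A $$ (i, j)))\<^sup>2)"

definition normal_mat :: "complex mat \<Rightarrow> bool" where
  "normal_mat A \<longleftrightarrow> square_mat A \<and> A * mat_adjoint A = mat_adjoint A * A"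

definition pos_semidef :: "complex mat \<Rightarrow> bool" where
  "pos_semidef P \<longleftrightarrow> square_mat P \<and> mat_adjoint P = P \<and>
     (\<forall>v \<in> carrier_vec (dim_row P). 0 \<le> Re ((P *\<^sub>v v) \<bullet>c v))"

(* The definite description is meant for positive semidefinite M, which has exactly one
   positive semidefinite square root. *)
definition mat_sqrt :: "complex mat \<Rightarrow> complex mat" where
  "mat_sqrt M = (THE P. pos_semidef P \<and> P * P = M)"

definition mat_abs :: "complex mat \<Rightarrow> complex mat" where
  "mat_abs A = mat_sqrt (mat_adjoint A * A)"

(* lam 1, ..., lam r lists the nonzero eigenvalues of A, each repeated according to its
   algebraic multiplicity; values of lam outside {1..r} are irrelevant. *)
definition nonzero_eigenvalues :: "complex mat \<Rightarrow> nat \<Rightarrow> (nat \<Rightarrow> complex) \<Rightarrow> bool" where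
  "nonzero_eigenvalues A r lam \<longleftrightarrow>
     (\<forall>j \<in> {1..r}. lam j \<noteq> 0) \<and>
     (\<forall>x. x \<noteq> 0 \<longrightarrow> card {j \<in> {1..r}. lam j = x} = order x (char_poly A))"

definition normal_with_eigenvalues ::
    "nat \<Rightarrow> nat \<Rightarrow> (nat \<Rightarrow> complex) \<Rightarrow> complex mat \<Rightarrow> bool" where
  "normal_with_eigenvalues n r lam A \<longleftrightarrow>
     A \<in> carrier_mat n n \<and> vec_space.rank n A = r \<and> normal_mat A \<and> nonzero_eigenvalues A r lam"

definition arrangements :: "nat \<Rightarrow> 'a set \<Rightarrow> 'a list set" where
  "arrangements k X = {xs. length xs = k \<and> distinct xs \<and> set xs \<subseteq> X}"

definition F_hat :: "nat \<Rightarrow> nat \<Rightarrow> (nat \<Rightarrow> complex) \<Rightarrow> (nat \<Rightarrow> complex) \<Rightarrow> real" where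
  "F_hat r s lam lamh = (\<Sum>j=1..r. (cmod (lam j))\<^sup>2) + (\<Sum>j=1..s. (cmod (lamh j))\<^sup>2)"

(* HOL has 0 / 0 = 0, whereas the quotient 0 / 0 in the minimum is to be read as 1. *)
definition quot :: "real \<Rightarrow> real \<Rightarrow> real" where
  "quot a b = (if a = 0 \<and> b = 0 then 1 else a / b)"

definition abs_coeff :: "nat \<Rightarrow> nat \<Rightarrow> (nat \<Rightarrow> complex) \<Rightarrow> (nat \<Rightarrow> complex) \<Rightarrow> real" where
  "abs_coeff r s lam lamh =
     Min {sqrt (quot (F_hat r s lam lamh - 2 * (\<Sum>t<k. cmod (lamh (p ! t)) * cmod (lam (q ! t))))
                     (F_hat r s lam lamh - 2 * (\<Sum>t<k. Re (lamh (p ! t) * cnj (lam (q ! t))))))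
          | k p q. 1 \<le> k \<and> k \<le> r \<and> p \<in> arrangements k {1..s} \<and> q \<in> arrangements k {1..r}}"

end

theory Submission
  imports Defs
begin

text \<open>
  Write \<open>A = U D U\<^sup>*\<close> and \<open>B = V E V\<^sup>*\<close> with \<open>U, V\<close> unitary and \<open>D, E\<close> diagonal, the lists of nonzero
  eigenvalues being filled up with zeros to length \<open>n\<close>, and put \<open>X = U\<^sup>* V\<close>. Unitary invariance of the
  Frobenius norm gives
  \<open>\<parallel>A - B\<parallel>\<^sup>2 = \<Sum>\<^sub>i\<^sub>j |X\<^sub>i\<^sub>j|\<^sup>2 |d\<^sub>i - e\<^sub>j|\<^sup>2\<close>, and since \<open>|A| = U |D| U\<^sup>*\<close> and \<open>|B| = V |E| V\<^sup>*\<close>, also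
  \<open>\<parallel>|A| - |B|\<parallel>\<^sup>2 = \<Sum>\<^sub>i\<^sub>j |X\<^sub>i\<^sub>j|\<^sup>2 (|d\<^sub>i| - |e\<^sub>j|)\<^sup>2\<close> with the same weights. For a constant \<open>c\<close> the
  inequality \<open>\<parallel>|A| - |B|\<parallel>\<^sup>2 \<ge> c\<^sup>2 \<parallel>A - B\<parallel>\<^sup>2\<close> is therefore linear in the doubly stochastic matrix
  \<open>|X\<^sub>i\<^sub>j|\<^sup>2\<close>, and by Birkhoff's theorem (\<open>birkhoff_nonneg\<close>, from Hall's marriage theorem) it suffices to
  check it on permutation matrices. A permutation pairs some of the nonzero \<open>\<lambda>\<close>'s with nonzero
  \<open>\<lambda>\<close>-hats, and the pairs that it makes are an arrangement of some length \<open>k \<le> r\<close>; expanding the squares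
  turns its two sums into the numerator and denominator of the quotient belonging to that
  arrangement (\<open>gap_of_permutation\<close>). For \<open>k = 0\<close> the two sums coincide and \<open>c \<le> 1\<close> is enough.

  For optimality take an arrangement at which the minimum is attained and extend it to a permutation of
  all \<open>n\<close> positions (\<open>gap_of_arrangement\<close>). The extension may be forced to pair further nonzero
  eigenvalues, but an additional pair \<open>(\<lambda>, \<mu>)\<close> lowers the numerator by \<open>2|\<lambda>||\<mu>|\<close> and the denominator by
  \<open>2 Re (\<mu> cnj \<lambda>) \<le> 2|\<lambda>||\<mu>|\<close>, so a quotient that is at most \<open>1\<close> cannot grow. Hence the two
  diagonal matrices listing the eigenvalues in this order attain the coefficient
  (\<open>abs_coeff_witness_permutation\<close>), unless they are equal. In that case the coefficient is \<open>1\<close>,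
  and every pair \<open>A \<noteq> B\<close> refutes a larger constant because \<open>\<parallel>|A| - |B|\<parallel> \<le> \<parallel>A - B\<parallel>\<close>.
\<close>

section \<open>Nonnegative matrices with constant row and column sums\<close>

text \<open>
  Rado's proof. A family of singletons satisfying Hall's condition is injective already. Otherwise some
  \<open>N i0\<close> has two elements \<open>x \<noteq> y\<close>, and one of them can be deleted without violating the condition:
  if both deletions failed, with witnesses \<open>P \<union> {i0}\<close> and \<open>Q \<union> {i0}\<close>, then counting the union
  and the intersection of the two neighbourhoods would contradict the condition for
  \<open>P \<union> Q \<union> {i0}\<close> and \<open>P \<inter> Q\<close>.
\<close>
lemma hall_marriage:
  fixes N :: "'a \<Rightarrow> 'b set"
  assumes "finite I" and "\<And>i. i \<in> I \<Longrightarrow> finite (N i)"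
    and "\<And>J. J \<subseteq> I \<Longrightarrow> card J \<le> card (\<Union>i\<in>J. N i)"
  shows "\<exists>f. inj_on f I \<and> (\<forall>i\<in>I. f i \<in> N i)"
  using assms(2,3)
proof (induction "\<Sum>i\<in>I. card (N i)" arbitrary: N rule: less_induct)
  case less
  note fin = less.prems(1) and hall = less.prems(2)
  have finJ: "finite J" if "J \<subseteq> I" for J
    using that assms(1) finite_subset by blast
  have finU: "finite (\<Union>i\<in>J. N i)" if "J \<subseteq> I" for J
    using that finJ[OF that] fin by blast
  show ?case
  proof (cases "\<exists>i0\<in>I. \<exists>x\<in>N i0. \<exists>y\<in>N i0. x \<noteq> y")
    case True
    then obtain i0 x y where i0: "i0 \<in> I" and x: "x \<in> N i0" and y: "y \<in> N i0" and xy: "x \<noteq> y"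
      by blast
    have violated: "\<exists>P. P \<subseteq> I - {i0} \<and> card ((\<Union>i\<in>P. N i) \<union> (N i0 - {z})) \<le> card P"
      if z: "z \<in> N i0"
        and none: "\<not> (\<exists>f. inj_on f I \<and> (\<forall>i\<in>I. f i \<in> N i))" for z
    proof -
      let ?N = "N(i0 := N i0 - {z})"
      \<comment> \<open>If the shrunk family satisfied Hall's condition, the induction hypothesis would contradict \<open>none\<close>.\<close>
      have "(\<Sum>i\<in>I. card (?N i)) < (\<Sum>i\<in>I. card (N i))"
      proof (rule sum_strict_mono_ex1)
        show "\<forall>i\<in>I. card (?N i) \<le> card (N i)"
          using fin by (auto intro: card_mono)
        show "\<exists>i\<in>I. card (?N i) < card (N i)"
          using i0 card_Diff1_less[OF fin[OF i0] z] by (intro bexI[of _ i0]) simp_all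
      qed (rule assms(1))
      moreover have "\<And>i. i \<in> I \<Longrightarrow> finite (?N i)" using fin by auto
      moreover have "\<not> (\<exists>f. inj_on f I \<and> (\<forall>i\<in>I. f i \<in> ?N i))"
      proof
        assume "\<exists>f. inj_on f I \<and> (\<forall>i\<in>I. f i \<in> ?N i)"
        then obtain f where f: "inj_on f I" "\<forall>i\<in>I. f i \<in> ?N i" by blast
        have "\<forall>i\<in>I. f i \<in> N i" using f(2) by (auto split: if_splits)
        with f(1) none show False by blast
      qed
      ultimately have "\<not> (\<forall>J\<subseteq>I. card J \<le> card (\<Union>i\<in>J. ?N i))"
        using less.hyps[of ?N] by blast
      then obtain J where J: "J \<subseteq> I" and lt: "card (\<Union>i\<in>J. ?N i) < card J"
        by (meson not_le)
      have "i0 \<in> J"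
      proof (rule ccontr)
        assume "i0 \<notin> J"
        then have "(\<Union>i\<in>J. ?N i) = (\<Union>i\<in>J. N i)" by auto
        with hall[OF J] lt show False by simp
      qed
      let ?P = "J - {i0}"
      have eq: "(\<Union>i\<in>J. ?N i) = (\<Union>i\<in>?P. N i) \<union> (N i0 - {z})"
        using \<open>i0 \<in> J\<close> by auto
      have cJ: "card J = Suc (card ?P)"
        using \<open>i0 \<in> J\<close> finJ[OF J] by (metis card.remove)
      have "card ((\<Union>i\<in>?P. N i) \<union> (N i0 - {z})) \<le> card ?P"
        using lt unfolding eq cJ by linarith
      then show ?thesis using J by blast
    qed
    show ?thesis
    proof (rule ccontr)
      assume none: "\<not> ?thesis"
      obtain P where P: "P \<subseteq> I - {i0}"
        and cP: "card ((\<Union>i\<in>P. N i) \<union> (N i0 - {x})) \<le> card P"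
        using violated[OF x none] by blast
      obtain Q where Q: "Q \<subseteq> I - {i0}"
        and cQ: "card ((\<Union>i\<in>Q. N i) \<union> (N i0 - {y})) \<le> card Q"
        using violated[OF y none] by blast
      let ?X = "(\<Union>i\<in>P. N i) \<union> (N i0 - {x})" and ?Y = "(\<Union>i\<in>Q. N i) \<union> (N i0 - {y})"
      have fP: "finite P" "finite Q" using P Q assms(1) finite_subset by blast+
      have fX: "finite ?X" "finite ?Y"
        using finU[of P] finU[of Q] P Q fin[OF i0] by auto
      have "card (insert i0 (P \<union> Q)) \<le> card (\<Union>i\<in>insert i0 (P \<union> Q). N i)"
        using hall[of "insert i0 (P \<union> Q)"] P Q i0 by blast
      also have "(\<Union>i\<in>insert i0 (P \<union> Q). N i) = ?X \<union> ?Y"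
        using xy x y by auto
      finally have 1: "Suc (card (P \<union> Q)) \<le> card (?X \<union> ?Y)"
        using P Q fP by (subst (asm) card_insert_disjoint) auto
      have "card (P \<inter> Q) \<le> card (\<Union>i\<in>P \<inter> Q. N i)"
        using hall[of "P \<inter> Q"] P by blast
      also have "\<dots> \<le> card (?X \<inter> ?Y)"
        using fX by (intro card_mono) auto
      finally have 2: "card (P \<inter> Q) \<le> card (?X \<inter> ?Y)" .
      \<comment> \<open>Together with 1 and 2 this gives \<open>|P| + |Q| \<ge> |P| + |Q| + 1\<close>.\<close>
      have "card ?X + card ?Y = card (?X \<union> ?Y) + card (?X \<inter> ?Y)"
        using card_Un_Int[OF fX] .
      moreover have "card P + card Q = card (P \<union> Q) + card (P \<inter> Q)"
        using card_Un_Int[OF fP] .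
      ultimately show False using 1 2 cP cQ by linarith
    qed
  next
    case False
    have ne: "N i \<noteq> {}" if "i \<in> I" for i
      using hall[of "{i}"] that by auto
    define f where "f = (\<lambda>i. SOME x. x \<in> N i)"
    have f: "f i \<in> N i" if "i \<in> I" for i
      unfolding f_def using ne[OF that] some_in_eq by blast
    have sing: "N i = {f i}" if "i \<in> I" for i
      using False f[OF that] that by blast
    have "inj_on f I"
    proof (rule inj_onI, rule ccontr)
      fix i j assume ij: "i \<in> I" "j \<in> I" "f i = f j" "i \<noteq> j"
      have "(\<Union>k\<in>{i, j}. N k) = {f i}" using sing ij by auto
      then show False using hall[of "{i, j}"] ij by simp
    qed
    with f show ?thesis by blast
  qed
qed

text \<open>
  Hall's condition holds for the supports of the rows: the rows in \<open>J\<close> have total mass \<open>t |J|\<close>, all of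
  which lies in the columns meeting their supports, and each column carries mass \<open>t\<close>.
\<close>
lemma permutation_in_support:
  fixes S :: "'a \<Rightarrow> 'a \<Rightarrow> real"
  assumes I: "finite I" and t: "0 < t"
    and nonneg: "\<And>i j. i \<in> I \<Longrightarrow> j \<in> I \<Longrightarrow> 0 \<le> S i j"
    and rows: "\<And>i. i \<in> I \<Longrightarrow> (\<Sum>j\<in>I. S i j) = t"
    and cols: "\<And>j. j \<in> I \<Longrightarrow> (\<Sum>i\<in>I. S i j) = t"
  shows "\<exists>\<sigma>. \<sigma> permutes I \<and> (\<forall>i\<in>I. 0 < S i (\<sigma> i))"
proof -
  let ?N = "\<lambda>i. {j\<in>I. 0 < S i j}"
  have "card J \<le> card (\<Union>i\<in>J. ?N i)" if J: "J \<subseteq> I" for J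
  proof -
    let ?M = "\<Union>i\<in>J. ?N i"
    have M: "?M \<subseteq> I" by auto
    have "t * card J = (\<Sum>i\<in>J. \<Sum>j\<in>I. S i j)"
      using rows J by (subst sum.cong[where h = "\<lambda>_. t", OF refl]) auto
    also have "\<dots> = (\<Sum>i\<in>J. \<Sum>j\<in>?M. S i j)"
    proof (rule sum.cong[OF refl])
      fix i assume i: "i \<in> J"
      show "(\<Sum>j\<in>I. S i j) = (\<Sum>j\<in>?M. S i j)"
      proof (rule sum.mono_neutral_right[OF I M], rule ballI)
        fix j assume "j \<in> I - ?M"
        then show "S i j = 0" using i J nonneg[of i j] by force
      qed
    qed
    also have "\<dots> = (\<Sum>j\<in>?M. \<Sum>i\<in>J. S i j)" by (rule sum.swap)
    also have "\<dots> \<le> (\<Sum>j\<in>?M. \<Sum>i\<in>I. S i j)"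
      using J nonneg I by (intro sum_mono sum_mono2) auto
    also have "\<dots> = (\<Sum>j\<in>?M. t)"
      using cols M by (intro sum.cong) auto
    finally have "t * card J \<le> t * card ?M" by (simp add: mult.commute)
    then show ?thesis using t by simp
  qed
  then obtain f where f: "inj_on f I" "\<forall>i\<in>I. f i \<in> ?N i"
    using hall_marriage[OF I, of ?N] I by auto
  have "f ` I = I"
    using f I by (intro endo_inj_surj) auto
  then have "bij_betw f I I" using f(1) by (simp add: bij_betw_def)
  then have "(\<lambda>i. if i \<in> I then f i else i) permutes I"
    by (intro bij_imp_permutes) (auto simp: bij_betw_def inj_on_def)
  then show ?thesis using f(2) by (intro exI[of _ "\<lambda>i. if i \<in> I then f i else i"]) auto
qed

text \<open>
  The dual form of Birkhoff's theorem: a linear functional that is nonnegative on permutation matrices is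
  nonnegative on doubly stochastic ones. Subtracting from \<open>S\<close> the largest possible multiple of a
  permutation matrix inside its support removes an entry from the support; allowing an arbitrary common
  line sum \<open>t\<close> keeps the remainder within the hypotheses.
\<close>
lemma birkhoff_nonneg:
  fixes S C :: "'a \<Rightarrow> 'a \<Rightarrow> real"
  assumes I: "finite I" and "0 \<le> t"
    and "\<And>i j. i \<in> I \<Longrightarrow> j \<in> I \<Longrightarrow> 0 \<le> S i j"
    and "\<And>i. i \<in> I \<Longrightarrow> (\<Sum>j\<in>I. S i j) = t"
    and "\<And>j. j \<in> I \<Longrightarrow> (\<Sum>i\<in>I. S i j) = t"
    and C: "\<And>\<sigma>. \<sigma> permutes I \<Longrightarrow> 0 \<le> (\<Sum>i\<in>I. C i (\<sigma> i))"
  shows "0 \<le> (\<Sum>i\<in>I. \<Sum>j\<in>I. S i j * C i j)"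
  using assms(2-5)
proof (induction "card {(i, j). i \<in> I \<and> j \<in> I \<and> S i j \<noteq> 0}" arbitrary: S t rule: less_induct)
  case less
  note nonneg = less.prems(2) and rows = less.prems(3) and cols = less.prems(4)
  let ?supp = "\<lambda>S. {(i, j). i \<in> I \<and> j \<in> I \<and> S i j \<noteq> (0::real)}"
  have fin: "finite (?supp S)" for S
    by (rule finite_subset[of _ "I \<times> I"]) (use I in auto)
  show ?case
  proof (cases "t = 0 \<or> I = {}")
    case True
    have "S i j = 0" if "i \<in> I" "j \<in> I" for i j
      using True rows[OF that(1)] nonneg[OF that(1)] I that sum_nonneg_eq_0_iff[of I "S i"] by auto
    then show ?thesis by simp
  next
    case False
    then have t: "0 < t" and ne: "I \<noteq> {}" using less.prems(1) by auto
    obtain \<sigma> where \<sigma>: "\<sigma> permutes I" and pos: "\<And>i. i \<in> I \<Longrightarrow> 0 < S i (\<sigma> i)"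
      using permutation_in_support[OF I t, of S] nonneg rows cols by blast
    define m where "m = Min ((\<lambda>i. S i (\<sigma> i)) ` I)"
    have m_le: "m \<le> S i (\<sigma> i)" if "i \<in> I" for i
      unfolding m_def using that I by auto
    have "m \<in> (\<lambda>i. S i (\<sigma> i)) ` I"
      unfolding m_def using I ne by (intro Min_in) auto
    then obtain i0 where i0: "i0 \<in> I" "m = S i0 (\<sigma> i0)" by auto
    have m: "0 < m" using pos i0 by simp
    define P where "P = (\<lambda>i j. if j = \<sigma> i then m else 0)"
    have in_I: "\<sigma> i \<in> I" if "i \<in> I" for i
      using that \<sigma> by (simp add: permutes_in_image)
    have Prow: "(\<Sum>j\<in>I. P i j) = m" if "i \<in> I" for i
      using I in_I[OF that] by (simp add: P_def)
    have Pcol: "(\<Sum>i\<in>I. P i j) = m" if "j \<in> I" for j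
    proof -
      have "(\<Sum>i\<in>I. P i j) = (\<Sum>i\<in>I. if i = inv_into UNIV \<sigma> j then m else 0)"
        unfolding P_def using permutes_inverses[OF \<sigma>] by (intro sum.cong) auto
      also have "\<dots> = m"
        using I that permutes_in_image[OF permutes_inv[OF \<sigma>], of j] by simp
      finally show ?thesis .
    qed
    have PC: "(\<Sum>i\<in>I. \<Sum>j\<in>I. P i j * C i j) = m * (\<Sum>i\<in>I. C i (\<sigma> i))"
    proof -
      have "(\<Sum>j\<in>I. P i j * C i j) = m * C i (\<sigma> i)" if "i \<in> I" for i
      proof -
        have "(\<Sum>j\<in>I. P i j * C i j) = (\<Sum>j\<in>I. if j = \<sigma> i then m * C i j else 0)"
          unfolding P_def by (intro sum.cong) auto
        then show ?thesis using I in_I[OF that] by simp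
      qed
      then show ?thesis by (simp add: sum_distrib_left)
    qed
    let ?R = "\<lambda>i j. S i j - P i j"
    have "0 \<le> (\<Sum>i\<in>I. \<Sum>j\<in>I. ?R i j * C i j)"
    proof (rule less.hyps[of ?R "t - m"])
      have "?supp ?R \<subset> ?supp S"
      proof (rule psubsetI)
        show "?supp ?R \<subseteq> ?supp S"
          using pos by (force simp: P_def split: if_splits)
        have "(i0, \<sigma> i0) \<in> ?supp S - ?supp ?R"
          using i0 in_I[OF i0(1)] m by (auto simp: P_def)
        then show "?supp ?R \<noteq> ?supp S" by blast
      qed
      then show "card (?supp ?R) < card (?supp S)"
        using fin by (rule psubset_card_mono[rotated])
      have "(\<Sum>j\<in>I. P i0 j) \<le> (\<Sum>j\<in>I. S i0 j)"
        using i0 nonneg by (intro sum_mono) (auto simp: P_def)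
      then show "0 \<le> t - m" using Prow rows i0 by simp
      show "\<And>i j. i \<in> I \<Longrightarrow> j \<in> I \<Longrightarrow> 0 \<le> ?R i j"
        using nonneg m_le by (auto simp: P_def)
      show "\<And>i. i \<in> I \<Longrightarrow> (\<Sum>j\<in>I. ?R i j) = t - m"
        using rows Prow by (simp add: sum_subtractf)
      show "\<And>j. j \<in> I \<Longrightarrow> (\<Sum>i\<in>I. ?R i j) = t - m"
        using cols Pcol by (simp add: sum_subtractf)
    qed
    moreover have "0 \<le> (\<Sum>i\<in>I. \<Sum>j\<in>I. P i j * C i j)"
      unfolding PC using m C[OF \<sigma>] by simp
    moreover have "(\<Sum>i\<in>I. \<Sum>j\<in>I. S i j * C i j)
        = (\<Sum>i\<in>I. \<Sum>j\<in>I. ?R i j * C i j) + (\<Sum>i\<in>I. \<Sum>j\<in>I. P i j * C i j)"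
      by (simp add: sum.distrib[symmetric] algebra_simps)
    ultimately show ?thesis by linarith
  qed
qed

lemma extend_partial_injection:
  assumes "finite I" "distinct p" "distinct q" "length p = length q" "set p \<subseteq> I" "set q \<subseteq> I"
  shows "\<exists>\<sigma>. \<sigma> permutes I \<and> (\<forall>t<length p. \<sigma> (p ! t) = q ! t)"
proof -
  have "card (set p) = card (set q)"
    using assms(2-4) by (metis distinct_card)
  then have "card (I - set p) = card (I - set q)"
    using card_Diff_subset[OF _ assms(5)] card_Diff_subset[OF _ assms(6)] by simp
  then obtain g where g: "bij_betw g (I - set p) (I - set q)"
    using finite_same_card_bij[of "I - set p" "I - set q"] assms(1) by auto
  define f where "f = (\<lambda>i. the (map_of (zip p q) i))"
  have f: "f (p ! t) = q ! t" if "t < length p" for t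
    unfolding f_def using that assms by (simp add: map_of_zip_nth)
  have "bij_betw f (set p) (set q)"
    unfolding bij_betw_def
  proof
    show "inj_on f (set p)"
    proof (rule inj_onI)
      fix i j assume "i \<in> set p" "j \<in> set p" and eq: "f i = f j"
      then obtain a b where "i = p ! a" "a < length p" "j = p ! b" "b < length p"
        by (metis in_set_conv_nth)
      then show "i = j" using eq f assms(3,4) by (simp add: nth_eq_iff_index_eq)
    qed
    have "map f p = q"
      using f assms(4) by (intro nth_equalityI) simp_all
    then show "f ` set p = set q" by (metis set_map)
  qed
  then have "bij_betw (\<lambda>i. if i \<in> set p then f i else g i)
      (set p \<union> (I - set p)) (set q \<union> (I - set q))"
    using g by (intro bij_betw_disjoint_Un) auto
  then have b: "bij_betw (\<lambda>i. if i \<in> set p then f i else g i) I I"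
    using assms(5,6) by (simp add: Un_absorb1)
  define \<sigma> where "\<sigma> = (\<lambda>i. if i \<in> I then if i \<in> set p then f i else g i else i)"
  have "bij_betw \<sigma> I I"
    using b by (rule iffD1[OF bij_betw_cong, rotated]) (simp add: \<sigma>_def)
  then have "\<sigma> permutes I" by (rule bij_imp_permutes) (simp add: \<sigma>_def)
  moreover have "\<sigma> (p ! t) = q ! t" if "t < length p" for t
    using that subsetD[OF assms(5) nth_mem[OF that]] f nth_mem[OF that] by (auto simp: \<sigma>_def)
  ultimately show ?thesis by blast
qed

section \<open>Unitary matrices and the Frobenius norm\<close>

lemma mat_adjoint_dim [simp]:
  "dim_row (mat_adjoint A) = dim_col A" "dim_col (mat_adjoint A) = dim_row A"
  by (simp_all add: mat_adjoint_def)

lemma mat_adjoint_carrier [simp]: "A \<in> carrier_mat m n \<Longrightarrow> mat_adjoint A \<in> carrier_mat n m"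
  by (metis carrier_matD carrier_matI mat_adjoint_dim)

lemma mat_adjoint_index [simp]:
  fixes A :: "complex mat"
  shows "i < dim_col A \<Longrightarrow> j < dim_row A \<Longrightarrow> mat_adjoint A $$ (i, j) = cnj (A $$ (j, i))"
  by (simp add: mat_adjoint_def mat_of_rows_def)

lemma mat_adjoint_adjoint [simp]:
  fixes A :: "complex mat"
  shows "mat_adjoint (mat_adjoint A) = A"
  by (rule eq_matI) auto

lemma mat_adjoint_mult:
  fixes A B :: "complex mat"
  assumes "A \<in> carrier_mat m n" "B \<in> carrier_mat n k"
  shows "mat_adjoint (A * B) = mat_adjoint B * mat_adjoint A"
  using assms by (intro eq_matI) (auto simp: scalar_prod_def mult.commute)

lemma mat_adjoint_one [simp]: "mat_adjoint (1\<^sub>m n :: complex mat) = 1\<^sub>m n"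
  by (rule eq_matI) auto

lemma mat_adjoint_mat_diag [simp]:
  "mat_adjoint (mat_diag n f :: complex mat) = mat_diag n (\<lambda>i. cnj (f i))"
  by (rule eq_matI) (auto simp: mat_diag_def)

definition unitary :: "nat \<Rightarrow> complex mat \<Rightarrow> bool" where
  "unitary n U \<longleftrightarrow> U \<in> carrier_mat n n \<and> mat_adjoint U * U = 1\<^sub>m n \<and> U * mat_adjoint U = 1\<^sub>m n"

lemma unitaryI:
  assumes "U \<in> carrier_mat n n" "mat_adjoint U * U = 1\<^sub>m n"
  shows "unitary n U"
  using assms mat_mult_left_right_inverse[of "mat_adjoint U" n U] by (simp add: unitary_def)

lemma unitaryD:
  assumes "unitary n U"
  shows "U \<in> carrier_mat n n" "mat_adjoint U * U = 1\<^sub>m n" "U * mat_adjoint U = 1\<^sub>m n"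
  using assms by (auto simp: unitary_def)

lemma unitary_one: "unitary n (1\<^sub>m n)"
  by (simp add: unitary_def)

lemma unitary_adjoint: "unitary n U \<Longrightarrow> unitary n (mat_adjoint U)"
  by (simp add: unitary_def)

lemma unitary_mult:
  assumes U: "unitary n U" and V: "unitary n V"
  shows "unitary n (U * V)"
proof (rule unitaryI)
  note c [simp] = unitaryD(1)[OF U] unitaryD(1)[OF V]
  show "U * V \<in> carrier_mat n n" by (meson c mult_carrier_mat)
  have "mat_adjoint (U * V) * (U * V) = mat_adjoint V * mat_adjoint U * (U * V)"
    by (simp add: mat_adjoint_mult[of _ n n _ n])
  also have "\<dots> = mat_adjoint V * (mat_adjoint U * (U * V))"
    by (simp add: assoc_mult_mat[of _ n n _ n _ n] mult_carrier_mat[of _ n n _ n])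
  also have "mat_adjoint U * (U * V) = (mat_adjoint U * U) * V"
    by (simp add: assoc_mult_mat[of _ n n _ n _ n] mult_carrier_mat[of _ n n _ n])
  finally show "mat_adjoint (U * V) * (U * V) = 1\<^sub>m n"
    using unitaryD(2)[OF U] unitaryD(2)[OF V] left_mult_one_mat[OF unitaryD(1)[OF V]] by simp
qed

lemma unitary_cancel:
  assumes U: "unitary n U" and M: "M \<in> carrier_mat n k"
  shows "mat_adjoint U * (U * M) = M" "U * (mat_adjoint U * M) = M"
proof -
  note c = unitaryD(1)[OF U]
  show "mat_adjoint U * (U * M) = M"
    using assoc_mult_mat[of "mat_adjoint U" n n U n M k] M c unitaryD(2)[OF U] by simp
  show "U * (mat_adjoint U * M) = M"
    using assoc_mult_mat[of U n n "mat_adjoint U" n M k] M c unitaryD(3)[OF U] by simp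
qed

lemma unitary_row_sum:
  assumes U: "unitary n U" and i: "i < n"
  shows "(\<Sum>j<n. (cmod (U $$ (i, j)))\<^sup>2) = 1"
proof -
  note c = unitaryD(1)[OF U]
  have "(U * mat_adjoint U) $$ (i, i) = (\<Sum>j<n. U $$ (i, j) * cnj (U $$ (i, j)))"
    using c i by (auto simp: scalar_prod_def atLeast0LessThan)
  also have "\<dots> = of_real (\<Sum>j<n. (cmod (U $$ (i, j)))\<^sup>2)"
    unfolding of_real_sum complex_norm_square ..
  finally have "complex_of_real (\<Sum>j<n. (cmod (U $$ (i, j)))\<^sup>2) = 1"
    using unitaryD(3)[OF U] i by simp
  then show ?thesis by (simp only: of_real_eq_1_iff)
qed

lemma unitary_col_sum:
  assumes U: "unitary n U" and j: "j < n"
  shows "(\<Sum>i<n. (cmod (U $$ (i, j)))\<^sup>2) = 1"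
proof -
  have "(\<Sum>i<n. (cmod (mat_adjoint U $$ (j, i)))\<^sup>2) = 1"
    using unitary_row_sum[OF unitary_adjoint[OF U] j] .
  then show ?thesis using unitaryD(1)[OF U] j by simp
qed

definition frob_sq :: "complex mat \<Rightarrow> real" where
  "frob_sq A = (\<Sum>i<dim_row A. \<Sum>j<dim_col A. (cmod (A $$ (i, j)))\<^sup>2)"

lemma frob_norm_eq_sqrt: "frob_norm A = sqrt (frob_sq A)"
  by (simp add: frob_norm_def frob_sq_def)

lemma frob_sq_adjoint: "frob_sq (mat_adjoint A) = frob_sq A"
  unfolding frob_sq_def by (subst sum.swap) simp

lemma frob_sq_trace:
  assumes "A \<in> carrier_mat m n"
  shows "complex_of_real (frob_sq A) = (\<Sum>j<n. (mat_adjoint A * A) $$ (j, j))"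
proof -
  have "(\<Sum>j<n. (mat_adjoint A * A) $$ (j, j)) = (\<Sum>j<n. \<Sum>i<m. cnj (A $$ (i, j)) * A $$ (i, j))"
    using assms by (intro sum.cong) (auto simp: scalar_prod_def atLeast0LessThan)
  also have "\<dots> = (\<Sum>i<m. \<Sum>j<n. cnj (A $$ (i, j)) * A $$ (i, j))"
    by (rule sum.swap)
  also have "\<dots> = complex_of_real (frob_sq A)"
    using assms unfolding frob_sq_def of_real_sum complex_norm_square by (simp add: mult.commute)
  finally show ?thesis by simp
qed

lemma frob_sq_unitary_left:
  assumes U: "unitary n U" and A: "A \<in> carrier_mat n k"
  shows "frob_sq (U * A) = frob_sq A"
proof -
  note c = unitaryD(1)[OF U]
  have "mat_adjoint (U * A) * (U * A) = mat_adjoint A * (mat_adjoint U * (U * A))"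
    using c A by (simp add: mat_adjoint_mult[of _ n n _ k] assoc_mult_mat[of _ k n _ n _ k])
  also have "\<dots> = mat_adjoint A * A" using unitary_cancel[OF U A] by simp
  finally have "complex_of_real (frob_sq (U * A)) = complex_of_real (frob_sq A)"
    using frob_sq_trace[of "U * A" n k] frob_sq_trace[of A n k] c A by simp
  then show ?thesis by (simp only: of_real_eq_iff)
qed

lemma frob_sq_unitary_right:
  assumes U: "unitary n U" and A: "A \<in> carrier_mat n n"
  shows "frob_sq (A * U) = frob_sq A"
proof -
  have "frob_sq (A * U) = frob_sq (mat_adjoint U * mat_adjoint A)"
    using unitaryD(1)[OF U] A by (metis frob_sq_adjoint mat_adjoint_mult)
  also have "\<dots> = frob_sq A"
    using frob_sq_unitary_left[OF unitary_adjoint[OF U], of "mat_adjoint A" n] A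
    by (simp add: frob_sq_adjoint)
  finally show ?thesis .
qed

text \<open>
  The normal matrix with eigenvalues \<open>d 0, \<dots>, d (n - 1)\<close> in the orthonormal basis formed by the
  columns of \<open>U\<close>.
\<close>
definition udiag :: "nat \<Rightarrow> complex mat \<Rightarrow> (nat \<Rightarrow> complex) \<Rightarrow> complex mat" where
  "udiag n U d = U * mat_diag n d * mat_adjoint U"

lemma udiag_carrier: "unitary n U \<Longrightarrow> udiag n U d \<in> carrier_mat n n"
  using unitaryD(1)[of n U] unfolding udiag_def by auto

lemma udiag_mult:
  assumes U: "unitary n U"
  shows "udiag n U d * udiag n U e = udiag n U (\<lambda>i. d i * e i)"
proof -
  note c [simp] = unitaryD(1)[OF U]
  note a = assoc_mult_mat[of _ n n _ n _ n] mult_carrier_mat[of _ n n _ n]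
  have "udiag n U d * udiag n U e
      = U * (mat_diag n d * (mat_adjoint U * (U * (mat_diag n e * mat_adjoint U))))"
    by (simp add: udiag_def a)
  also have "mat_adjoint U * (U * (mat_diag n e * mat_adjoint U)) = mat_diag n e * mat_adjoint U"
    by (rule unitary_cancel[OF U, of _ n]) (simp add: a)
  also have "U * (mat_diag n d * (mat_diag n e * mat_adjoint U))
      = U * (mat_diag n d * mat_diag n e) * mat_adjoint U"
    by (simp only: a c mat_adjoint_carrier mat_diag_dim mult_carrier_mat[of _ n n _ n])
  finally show ?thesis by (simp add: udiag_def)
qed

lemma udiag_adjoint:
  assumes U: "unitary n U"
  shows "mat_adjoint (udiag n U d) = udiag n U (\<lambda>i. cnj (d i))"
  using unitaryD(1)[OF U] unfolding udiag_def
  by (simp add: mat_adjoint_mult[of _ n n _ n] assoc_mult_mat[of _ n n _ n _ n] mult_carrier_mat[of _ n n _ n])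

text \<open>
  Multiplying by \<open>U\<^sup>*\<close> on the left and by \<open>V\<close> on the right leaves the norm unchanged and turns the
  difference into \<open>D X - X E\<close> with \<open>X = U\<^sup>* V\<close>, whose entries are \<open>X\<^sub>i\<^sub>j (d\<^sub>i - e\<^sub>j)\<close>.
\<close>
lemma frob_sq_udiag_diff:
  assumes U: "unitary n U" and V: "unitary n V"
  shows "frob_sq (udiag n U d - udiag n V e)
    = (\<Sum>i<n. \<Sum>j<n. (cmod ((mat_adjoint U * V) $$ (i, j)))\<^sup>2 * (cmod (d i - e j))\<^sup>2)"
proof -
  note c [simp] = unitaryD(1)[OF U] unitaryD(1)[OF V]
  note a = assoc_mult_mat[of _ n n _ n _ n] mult_carrier_mat[of _ n n _ n]
  let ?X = "mat_adjoint U * V"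
  have X [simp]: "?X \<in> carrier_mat n n" by (meson c mat_adjoint_carrier mult_carrier_mat)
  have M: "udiag n U d - udiag n V e \<in> carrier_mat n n"
    using udiag_carrier[OF U] udiag_carrier[OF V] by (metis minus_carrier_mat)
  have 1: "mat_adjoint U * udiag n U d * V = mat_diag n d * ?X"
  proof -
    have "mat_adjoint U * udiag n U d * V = mat_adjoint U * (U * (mat_diag n d * ?X))"
      by (simp add: udiag_def a)
    then show ?thesis using unitary_cancel(1)[OF U, of "mat_diag n d * ?X" n] by (simp add: a)
  qed
  have 2: "mat_adjoint U * udiag n V e * V = ?X * mat_diag n e"
  proof -
    have "mat_adjoint U * udiag n V e * V = ?X * mat_diag n e * (mat_adjoint V * V)"
      by (simp add: udiag_def a)
    then show ?thesis
      using unitaryD(2)[OF V] right_mult_one_mat[OF mult_carrier_mat[OF X mat_diag_dim]] by simp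
  qed
  have "frob_sq (udiag n U d - udiag n V e)
      = frob_sq (mat_adjoint U * (udiag n U d - udiag n V e) * V)"
    using frob_sq_unitary_left[OF unitary_adjoint[OF U] M] M
      frob_sq_unitary_right[OF V mult_carrier_mat[OF mat_adjoint_carrier[OF c(1)] M]] by simp
  also have "mat_adjoint U * (udiag n U d - udiag n V e) * V = mat_diag n d * ?X - ?X * mat_diag n e"
    unfolding 1[symmetric] 2[symmetric]
    using udiag_carrier[OF U] udiag_carrier[OF V]
    by (simp add: mult_minus_distrib_mat[of _ n n _ n] minus_mult_distrib_mat[of _ n n _ _ n] a)
  also have "mat_diag n d * ?X - ?X * mat_diag n e
      = Matrix.mat n n (\<lambda>(i, j). ?X $$ (i, j) * (d i - e j))"
    unfolding mat_diag_mult_left[OF X] mat_diag_mult_right[OF X]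
    by (rule eq_matI) (auto simp: algebra_simps)
  finally show ?thesis
    by (simp add: frob_sq_def norm_mult power_mult_distrib)
qed

section \<open>The spectral theorem for normal matrices\<close>

text \<open>
  Gram--Schmidt over a general field yields only an orthogonal basis; dividing its vectors by their
  Euclidean lengths makes the matrix unitary.
\<close>
lemma unit_eigenvector_completion:
  fixes v :: "complex vec"
  assumes v: "v \<in> carrier_vec n" "v \<noteq> 0\<^sub>v n"
  shows "\<exists>U c. unitary n U \<and> 0 < n \<and> col U 0 = c \<cdot>\<^sub>v v"
proof -
  interpret cof_vec_space n "TYPE(complex)" .
  have n: "0 < n" using v by (cases n) auto
  define ws where "ws = gram_schmidt n (basis_completion v)"
  note b = basis_completion[OF v]
  note g = gram_schmidt_result[OF b(2) b(4) b(5) ws_def]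
  have len: "length ws = n" using g(4) b(6) by simp
  obtain vs where vs: "basis_completion v = v # vs"
    using b(6,7) n by (cases "basis_completion v") auto
  have hd: "ws ! 0 = v"
    using gram_schmidt_hd[OF v(1), of vs] len n unfolding ws_def vs
    by (metis hd_conv_nth length_greater_0_conv)
  have wc: "ws ! i \<in> carrier_vec n" if "i < n" for i
    using g(3) len that nth_mem by blast
  define nrm where "nrm = (\<lambda>i. sqrt (\<Sum>k<n. (cmod (ws ! i $ k))\<^sup>2))"
  have sp: "ws ! i \<bullet>c ws ! i = of_real ((nrm i)\<^sup>2)" if "i < n" for i
  proof -
    have "ws ! i \<bullet>c ws ! i = (\<Sum>k<n. ws ! i $ k * cnj (ws ! i $ k))"
      using wc[OF that] by (auto simp: scalar_prod_def atLeast0LessThan)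
    also have "\<dots> = of_real (\<Sum>k<n. (cmod (ws ! i $ k))\<^sup>2)"
      unfolding of_real_sum complex_norm_square ..
    also have "(\<Sum>k<n. (cmod (ws ! i $ k))\<^sup>2) = (nrm i)\<^sup>2"
      unfolding nrm_def by (simp add: sum_nonneg)
    finally show ?thesis .
  qed
  have nz: "nrm i \<noteq> 0" if "i < n" for i
    using corthogonalD[OF g(2), of i i] sp[OF that] that len by auto
  define U where "U = Matrix.mat n n (\<lambda>(k, i). ws ! i $ k / of_real (nrm i))"
  have U: "U \<in> carrier_mat n n" by (simp add: U_def)
  have "mat_adjoint U * U = 1\<^sub>m n"
  proof (rule eq_matI)
    fix i j assume "i < dim_row (1\<^sub>m n :: complex mat)" "j < dim_col (1\<^sub>m n :: complex mat)"
    then have i: "i < n" and j: "j < n" by auto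
    have "(mat_adjoint U * U) $$ (i, j)
        = (\<Sum>k<n. cnj (ws ! i $ k / of_real (nrm i)) * (ws ! j $ k / of_real (nrm j)))"
      using U i j by (auto simp: scalar_prod_def atLeast0LessThan U_def)
    also have "\<dots> = (\<Sum>k<n. ws ! j $ k * cnj (ws ! i $ k)) / (of_real (nrm i) * of_real (nrm j))"
      by (simp add: sum_divide_distrib mult.commute)
    also have "(\<Sum>k<n. ws ! j $ k * cnj (ws ! i $ k)) = ws ! j \<bullet>c ws ! i"
      using wc[OF i] wc[OF j] by (auto simp: scalar_prod_def atLeast0LessThan)
    also have "ws ! j \<bullet>c ws ! i / (of_real (nrm i) * of_real (nrm j)) = (if i = j then 1 else 0)"
      using corthogonalD[OF g(2), of j i] sp[OF i] nz[OF i] i j len by (auto simp: power2_eq_square)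
    finally show "(mat_adjoint U * U) $$ (i, j) = 1\<^sub>m n $$ (i, j)"
      using i j by simp
  qed (use U in auto)
  then have "unitary n U" using U by (rule unitaryI[rotated])
  moreover have "col U 0 = (1 / of_real (nrm 0)) \<cdot>\<^sub>v v"
    using n v(1) hd by (intro eq_vecI) (auto simp: U_def)
  ultimately show ?thesis using n by blast
qed

lemma normal_matI:
  assumes "A \<in> carrier_mat n n" "A * mat_adjoint A = mat_adjoint A * A"
  shows "normal_mat A"
  using assms by (auto simp: normal_mat_def)

lemma normal_unitary_conj:
  assumes A: "A \<in> carrier_mat n n" and N: "normal_mat A" and U: "unitary n U"
  shows "normal_mat (mat_adjoint U * A * U)"
proof (rule normal_matI)
  note c [simp] = unitaryD(1)[OF U] A
  note a = assoc_mult_mat[of _ n n _ n _ n] mult_carrier_mat[of _ n n _ n]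
  show "mat_adjoint U * A * U \<in> carrier_mat n n" by (simp add: a)
  have adj: "mat_adjoint (mat_adjoint U * A * U) = mat_adjoint U * (mat_adjoint A * U)"
    by (simp add: mat_adjoint_mult[of _ n n _ n] a)
  have "mat_adjoint U * A * U * mat_adjoint (mat_adjoint U * A * U)
      = mat_adjoint U * (A * (U * (mat_adjoint U * (mat_adjoint A * U))))"
    unfolding adj by (simp add: a)
  also have "\<dots> = mat_adjoint U * (A * mat_adjoint A * U)"
    using unitary_cancel(2)[OF U, of "mat_adjoint A * U" n] by (simp add: a)
  also have "A * mat_adjoint A = mat_adjoint A * A"
    using N by (simp add: normal_mat_def)
  also have "mat_adjoint U * (mat_adjoint A * A * U)
      = mat_adjoint U * (mat_adjoint A * (U * (mat_adjoint U * (A * U))))"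
    using unitary_cancel(2)[OF U, of "A * U" n] by (simp add: a)
  also have "\<dots> = mat_adjoint (mat_adjoint U * A * U) * (mat_adjoint U * A * U)"
    unfolding adj by (simp add: a)
  finally show "mat_adjoint U * A * U * mat_adjoint (mat_adjoint U * A * U)
      = mat_adjoint (mat_adjoint U * A * U) * (mat_adjoint U * A * U)" .
qed

text \<open>
  For normal matrices this turns a first column that vanishes below the diagonal into a first row that
  vanishes to the right of it.
\<close>
lemma normal_mat_row_col_norm:
  assumes A: "A \<in> carrier_mat n n" and N: "normal_mat A" and i: "i < n"
  shows "(\<Sum>j<n. (cmod (A $$ (i, j)))\<^sup>2) = (\<Sum>j<n. (cmod (A $$ (j, i)))\<^sup>2)"
proof -
  have "complex_of_real (\<Sum>j<n. (cmod (A $$ (i, j)))\<^sup>2) = (A * mat_adjoint A) $$ (i, i)"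
    using A i unfolding of_real_sum complex_norm_square
    by (auto simp: scalar_prod_def atLeast0LessThan)
  also have "\<dots> = (mat_adjoint A * A) $$ (i, i)"
    using N by (simp add: normal_mat_def)
  also have "\<dots> = complex_of_real (\<Sum>j<n. (cmod (A $$ (j, i)))\<^sup>2)"
    using A i unfolding of_real_sum complex_norm_square
    by (auto simp: scalar_prod_def atLeast0LessThan mult.commute)
  finally show ?thesis by (simp only: of_real_eq_iff)
qed

lemma four_block_diag_mult:
  assumes "A1 \<in> carrier_mat 1 1" "B1 \<in> carrier_mat 1 1"
    and "A2 \<in> carrier_mat m m" "B2 \<in> carrier_mat m m"
  shows "four_block_mat A1 (0\<^sub>m 1 m) (0\<^sub>m m 1) A2 * four_block_mat B1 (0\<^sub>m 1 m) (0\<^sub>m m 1) B2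
    = four_block_mat (A1 * B1) (0\<^sub>m 1 m) (0\<^sub>m m 1) (A2 * B2)"
  by (subst mult_four_block_mat[of _ 1 1 _ m _ m _ _ 1 _ m]) (use assms in auto)

lemma four_block_diag_adjoint:
  fixes A1 A2 :: "complex mat"
  assumes "A1 \<in> carrier_mat 1 1" "A2 \<in> carrier_mat m m"
  shows "mat_adjoint (four_block_mat A1 (0\<^sub>m 1 m) (0\<^sub>m m 1) A2)
    = four_block_mat (mat_adjoint A1) (0\<^sub>m 1 m) (0\<^sub>m m 1) (mat_adjoint A2)"
  by (rule eq_matI) (use assms in auto)

text \<open>
  Induction on the size. A unitary matrix whose first column is an eigenvector for the first eigenvalue
  \<open>e\<close> conjugates \<open>A\<close> to a matrix with first column \<open>(e, 0, \<dots>, 0)\<close>; comparing the norms of its first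
  row and column shows that its first row is \<open>(e, 0, \<dots>, 0)\<close> as well, so the remaining block is normal
  and has the other eigenvalues. The eigenvalues may be prescribed in any order.
\<close>
lemma spectral_theorem_normal:
  assumes "A \<in> carrier_mat n n" and "normal_mat A"
    and "char_poly A = (\<Prod>e\<leftarrow>es. [:- e, 1:])"
  shows "\<exists>U. unitary n U \<and> A = udiag n U (\<lambda>i. es ! i)"
  using assms
proof (induction es arbitrary: n A)
  case Nil
  then have "n = 0" using degree_monic_char_poly[of A n] by simp
  then show ?case using Nil(1) unitary_one[of 0]
    by (intro exI[of _ "1\<^sub>m 0"]) (auto simp: udiag_def)
next
  case (Cons e es)
  note A = Cons.prems(1) and N = Cons.prems(2) and cp = Cons.prems(3)
  have "eigenvalue A e"
    unfolding eigenvalue_root_char_poly[OF A] cp by simp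
  then obtain v where "eigenvector A v e" by (auto simp: eigenvalue_def)
  then have v: "v \<in> carrier_vec n" "v \<noteq> 0\<^sub>v n" "A *\<^sub>v v = e \<cdot>\<^sub>v v"
    using A by (auto simp: eigenvector_def)
  obtain W c where W: "unitary n W" and n: "0 < n" and W0: "col W 0 = c \<cdot>\<^sub>v v"
    using unit_eigenvector_completion[OF v(1,2)] by blast
  note cW [simp] = unitaryD(1)[OF W] A
  obtain m where m: "n = Suc m" using n by (cases n) auto
  define B where "B = mat_adjoint W * A * W"
  note a = assoc_mult_mat[of _ n n _ n _ n] mult_carrier_mat[of _ n n _ n]
  have B [simp]: "B \<in> carrier_mat n n" by (simp add: B_def a)
  have NB: "normal_mat B" unfolding B_def by (rule normal_unitary_conj[OF A N W])
  have A_eq: "A = W * B * mat_adjoint W"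
  proof -
    have "W * B * mat_adjoint W = W * (mat_adjoint W * (A * (W * mat_adjoint W)))"
      by (simp add: B_def a)
    also have "\<dots> = A"
      using unitary_cancel(2)[OF W A] unitaryD(3)[OF W] right_mult_one_mat[OF A] by simp
    finally show ?thesis by simp
  qed
  have AW: "A * W = W * B"
    using unitary_cancel(2)[OF W, of "A * W" n] by (simp add: B_def a)
  have col0: "B $$ (i, 0) = (if i = 0 then e else 0)" if i: "i < n" for i
  proof -
    have "col (A * W) 0 = A *\<^sub>v col W 0"
      by (rule col_mult2[OF A unitaryD(1)[OF W] n])
    also have "\<dots> = e \<cdot>\<^sub>v col W 0"
      unfolding W0 using v A by (simp add: mult_mat_vec[OF A v(1)] smult_smult_assoc mult.commute)
    finally have c0: "col (A * W) 0 = e \<cdot>\<^sub>v col W 0" .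
    have "B $$ (i, 0) = (mat_adjoint W * (A * W)) $$ (i, 0)"
      by (simp add: B_def a)
    also have "\<dots> = row (mat_adjoint W) i \<bullet> col (A * W) 0"
      using i n carrier_matD[OF unitaryD(1)[OF W]] carrier_matD[OF A] by simp
    also have "\<dots> = e * (row (mat_adjoint W) i \<bullet> col W 0)"
      unfolding c0 using i carrier_matD[OF unitaryD(1)[OF W]]
      by (intro scalar_prod_smult_right) simp
    also have "row (mat_adjoint W) i \<bullet> col W 0 = (mat_adjoint W * W) $$ (i, 0)"
      using i n carrier_matD[OF unitaryD(1)[OF W]] carrier_matD[OF A] by simp
    also have "\<dots> = (if i = 0 then 1 else 0)"
      using unitaryD(2)[OF W] i n by simp
    finally show ?thesis by simp
  qed
  have row0: "B $$ (0, j) = 0" if j: "j < n" "j \<noteq> 0" for j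
  proof -
    have "(\<Sum>j<n. (cmod (B $$ (0, j)))\<^sup>2) = (\<Sum>j<n. (cmod (B $$ (j, 0)))\<^sup>2)"
      by (rule normal_mat_row_col_norm[OF B NB n])
    also have "\<dots> = (cmod (B $$ (0, 0)))\<^sup>2"
      using n col0 by (subst sum.remove[of _ 0]) auto
    finally have "(\<Sum>j\<in>{..<n} - {0}. (cmod (B $$ (0, j)))\<^sup>2) = 0"
      using n by (subst (asm) sum.remove[of _ 0]) auto
    then show ?thesis using j by (subst (asm) sum_nonneg_eq_0_iff) auto
  qed
  let ?E = "Matrix.mat 1 1 (\<lambda>_. e)"
  define B' where "B' = Matrix.mat m m (\<lambda>(i, j). B $$ (Suc i, Suc j))"
  have B' [simp]: "B' \<in> carrier_mat m m" by (simp add: B'_def)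
  have B_eq: "B = four_block_mat ?E (0\<^sub>m 1 m) (0\<^sub>m m 1) B'"
  proof (rule eq_matI)
    fix i j assume "i < dim_row (four_block_mat ?E (0\<^sub>m 1 m) (0\<^sub>m m 1) B')"
      "j < dim_col (four_block_mat ?E (0\<^sub>m 1 m) (0\<^sub>m m 1) B')"
    then have "i < n" "j < n" using m by (auto simp: B'_def)
    then show "B $$ (i, j) = four_block_mat ?E (0\<^sub>m 1 m) (0\<^sub>m m 1) B' $$ (i, j)"
      using col0 row0 m by (auto simp: B'_def)
  qed (use m B in \<open>auto simp: B'_def\<close>)
  have NB': "normal_mat B'"
  proof (rule normal_matI[OF B'])
    have "B * mat_adjoint B = four_block_mat (?E * mat_adjoint ?E) (0\<^sub>m 1 m) (0\<^sub>m m 1) (B' * mat_adjoint B')"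
      unfolding B_eq by (simp add: four_block_diag_adjoint four_block_diag_mult del: One_nat_def)
    moreover have "mat_adjoint B * B = four_block_mat (mat_adjoint ?E * ?E) (0\<^sub>m 1 m) (0\<^sub>m m 1) (mat_adjoint B' * B')"
      unfolding B_eq by (simp add: four_block_diag_adjoint four_block_diag_mult del: One_nat_def)
    ultimately have eq: "four_block_mat (?E * mat_adjoint ?E) (0\<^sub>m 1 m) (0\<^sub>m m 1) (B' * mat_adjoint B')
        = four_block_mat (mat_adjoint ?E * ?E) (0\<^sub>m 1 m) (0\<^sub>m m 1) (mat_adjoint B' * B')"
      using NB by (simp add: normal_mat_def)
    show "B' * mat_adjoint B' = mat_adjoint B' * B'"
    proof (rule eq_matI)
      fix i j assume "i < dim_row (mat_adjoint B' * B')" "j < dim_col (mat_adjoint B' * B')"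
      then have "i < m" "j < m" by (simp_all add: B'_def)
      then show "(B' * mat_adjoint B') $$ (i, j) = (mat_adjoint B' * B') $$ (i, j)"
        using arg_cong[OF eq, of "\<lambda>M. M $$ (Suc i, Suc j)"] by (simp add: B'_def)
    qed (simp_all add: B'_def)
  qed
  have "char_poly B = char_poly A"
  proof (rule char_poly_similar[OF similar_matI])
    show "{B, A, mat_adjoint W, W} \<subseteq> carrier_mat n n" by simp
    show "mat_adjoint W * W = 1\<^sub>m n" "W * mat_adjoint W = 1\<^sub>m n"
      using unitaryD[OF W] by simp_all
    show "B = mat_adjoint W * A * W" by (rule B_def)
  qed
  moreover have "char_poly B = char_poly ?E * char_poly B'"
    unfolding B_eq by (rule char_poly_four_block_zeros_col) auto
  moreover have "char_poly ?E = [:- e, 1:]"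
    by (simp add: char_poly_defs det_def sign_def)
  ultimately have "[:- e, 1:] * char_poly B' = [:- e, 1:] * (\<Prod>e\<leftarrow>es. [:- e, 1:])"
    using cp by simp
  then have "char_poly B' = (\<Prod>e\<leftarrow>es. [:- e, 1:])"
    by (metis mult_cancel_left pCons_eq_0_iff zero_neq_one)
  from Cons.IH[OF B' NB' this] obtain V where V: "unitary m V" and BV: "B' = udiag m V (\<lambda>i. es ! i)"
    by blast
  note cV [simp] = unitaryD(1)[OF V]
  define V1 where "V1 = four_block_mat (1\<^sub>m 1) (0\<^sub>m 1 m) (0\<^sub>m m 1) V"
  have cV1 [simp]: "V1 \<in> carrier_mat n n" 
    using four_block_carrier_mat[OF one_carrier_mat[of 1] unitaryD(1)[OF V]] unfolding V1_def m by simp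
  have V1: "unitary n V1"
  proof (rule unitaryI[OF cV1])
    show "mat_adjoint V1 * V1 = 1\<^sub>m n"
      unfolding V1_def using unitaryD(2)[OF V]
      by (simp add: four_block_diag_adjoint four_block_diag_mult m plus_1_eq_Suc del: One_nat_def)
  qed
  have "mat_diag n (\<lambda>i. (e # es) ! i) = four_block_mat ?E (0\<^sub>m 1 m) (0\<^sub>m m 1) (mat_diag m (\<lambda>i. es ! i))"
    unfolding m by (rule eq_matI) (auto simp: mat_diag_def nth_Cons' )
  then have B_diag: "B = udiag n V1 (\<lambda>i. (e # es) ! i)"
    unfolding B_eq BV udiag_def V1_def
    by (simp add: four_block_diag_adjoint four_block_diag_mult mult_carrier_mat[of _ m m _ m]
        del: One_nat_def)
  have "A = udiag n (W * V1) (\<lambda>i. (e # es) ! i)"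
    unfolding A_eq B_diag udiag_def by (simp add: mat_adjoint_mult[of _ n n _ n] a)
  then show ?case using unitary_mult[OF W V1] by blast
qed

section \<open>Uniqueness of positive semidefinite square roots\<close>

text \<open>
  Equality means that \<open>D X = X E\<close>; it is read off entrywise from the vanishing of the Frobenius norm of
  the difference.
\<close>
lemma udiag_index:
  assumes U: "unitary n U" and V: "unitary n V" and eq: "udiag n U d = udiag n V e"
    and "i < n" "j < n"
  shows "d i * (mat_adjoint U * V) $$ (i, j) = (mat_adjoint U * V) $$ (i, j) * e j"
proof -
  have "(\<Sum>i<n. \<Sum>j<n. (cmod ((mat_adjoint U * V) $$ (i, j)))\<^sup>2 * (cmod (d i - e j))\<^sup>2)
      = frob_sq (udiag n U d - udiag n V e)"
    by (rule frob_sq_udiag_diff[OF U V, symmetric])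
  also have "\<dots> = 0"
    unfolding eq using udiag_carrier[OF V, of e] by (simp add: frob_sq_def)
  finally have "(\<Sum>i<n. \<Sum>j<n. (cmod ((mat_adjoint U * V) $$ (i, j)))\<^sup>2 * (cmod (d i - e j))\<^sup>2) = 0" .
  then have "\<forall>i<n. \<forall>j<n. (cmod ((mat_adjoint U * V) $$ (i, j)))\<^sup>2 * (cmod (d i - e j))\<^sup>2 = 0"
    by (simp add: sum_nonneg_eq_0_iff sum_nonneg)
  then show ?thesis using assms(4,5) by auto
qed

lemma frob_sq_eq_0:
  assumes "A \<in> carrier_mat n n" "B \<in> carrier_mat n n"
  shows "frob_sq (A - B) = 0 \<longleftrightarrow> A = B"
proof
  assume "frob_sq (A - B) = 0"
  then have "\<forall>i<n. \<forall>j<n. A $$ (i, j) = B $$ (i, j)"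
    using assms by (simp add: frob_sq_def sum_nonneg_eq_0_iff sum_nonneg)
  then show "A = B" using assms by (intro eq_matI) auto
qed (use assms in \<open>simp add: frob_sq_def\<close>)

lemma udiag_eqI:
  assumes U: "unitary n U" and V: "unitary n V"
    and "\<And>i j. i < n \<Longrightarrow> j < n \<Longrightarrow> (mat_adjoint U * V) $$ (i, j) \<noteq> 0 \<Longrightarrow> d i = e j"
  shows "udiag n U d = udiag n V e"
proof -
  have "frob_sq (udiag n U d - udiag n V e) = 0"
    unfolding frob_sq_udiag_diff[OF U V]
    using assms(3) by (intro sum.neutral ballI) auto
  then show ?thesis
    using frob_sq_eq_0 udiag_carrier[OF U] udiag_carrier[OF V] by blast
qed

lemma mat_diag_mult_vec:
  fixes w :: "complex vec"
  assumes w: "w \<in> carrier_vec n" and i: "i < n"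
  shows "(mat_diag n d *\<^sub>v w) $ i = d i * w $ i"
proof -
  have "(mat_diag n d *\<^sub>v w) $ i = (\<Sum>j<n. (if i = j then d j else 0) * w $ j)"
    using w i by (auto simp: mat_diag_def scalar_prod_def atLeast0LessThan intro!: sum.cong)
  also have "\<dots> = (\<Sum>j<n. if j = i then d j * w $ j else 0)"
    by (intro sum.cong) auto
  finally show ?thesis using i by simp
qed

lemma udiag_quadratic_form:
  assumes U: "unitary n U" and v: "v \<in> carrier_vec n"
  shows "(udiag n U d *\<^sub>v v) \<bullet>c v
    = (\<Sum>i<n. d i * of_real ((cmod ((mat_adjoint U *\<^sub>v v) $ i))\<^sup>2))"
proof -
  note c = unitaryD(1)[OF U]
  define w where "w = mat_adjoint U *\<^sub>v v"
  have w: "w \<in> carrier_vec n" unfolding w_def using c v by (metis mat_adjoint_carrier mult_mat_vec_carrier)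
  define z where "z = mat_diag n d *\<^sub>v w"
  have z: "z \<in> carrier_vec n" unfolding z_def using w by (metis mat_diag_dim mult_mat_vec_carrier)
  have zi: "z $ i = d i * w $ i" if "i < n" for i
    unfolding z_def by (rule mat_diag_mult_vec[OF w that])
  have "(udiag n U d *\<^sub>v v) \<bullet>c v = (U *\<^sub>v z) \<bullet>c v"
    unfolding udiag_def z_def w_def using c v
    by (simp add: assoc_mult_mat_vec[of _ n n _ n] mult_carrier_mat[of _ n n _ n]
        mult_mat_vec_carrier[of _ n n])
  also have "\<dots> = (\<Sum>i<n. (\<Sum>k<n. U $$ (i, k) * z $ k) * cnj (v $ i))"
    using c v z by (auto simp: scalar_prod_def atLeast0LessThan)
  also have "\<dots> = (\<Sum>k<n. z $ k * cnj (\<Sum>i<n. cnj (U $$ (i, k)) * v $ i))"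
    unfolding sum_distrib_right cnj_sum sum_distrib_left
    by (subst sum.swap) (simp add: mult_ac)
  also have "\<dots> = (\<Sum>k<n. z $ k * cnj (w $ k))"
    unfolding w_def using c v by (intro sum.cong) (auto simp: scalar_prod_def atLeast0LessThan)
  also have "\<dots> = (\<Sum>i<n. d i * of_real ((cmod (w $ i))\<^sup>2))"
    unfolding complex_norm_square using zi by (intro sum.cong) simp_all
  finally show ?thesis unfolding w_def .
qed

lemma pos_semidef_udiag_iff:
  assumes U: "unitary n U"
  shows "pos_semidef (udiag n U d) \<longleftrightarrow> (\<forall>i<n. d i \<in> \<real> \<and> 0 \<le> Re (d i))"
proof
  note c = unitaryD(1)[OF U]
  note cd = udiag_carrier[OF U, of d]
  assume psd: "pos_semidef (udiag n U d)"
  show "\<forall>i<n. d i \<in> \<real> \<and> 0 \<le> Re (d i)"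
  proof (intro allI impI conjI)
    fix i assume i: "i < n"
    have "udiag n U (\<lambda>i. cnj (d i)) = udiag n U d"
      using psd udiag_adjoint[OF U, of d] by (simp add: pos_semidef_def)
    from udiag_index[OF U U this i i] have "cnj (d i) = d i"
      using unitaryD(2)[OF U] i by simp
    then show "d i \<in> \<real>" by (simp add: Reals_cnj_iff)
    define v where "v = U *\<^sub>v unit_vec n i"
    have v: "v \<in> carrier_vec n" using c by (simp add: v_def mult_mat_vec_carrier[of _ n n])
    have "mat_adjoint U *\<^sub>v v = unit_vec n i"
      using c unitaryD(2)[OF U]
      by (simp add: v_def assoc_mult_mat_vec[of _ n n _ n, symmetric])
    then have "(udiag n U d *\<^sub>v v) \<bullet>c v = (\<Sum>k<n. d k * of_real ((cmod (unit_vec n i $ k))\<^sup>2))"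
      using udiag_quadratic_form[OF U v] by simp
    also have "\<dots> = (\<Sum>k<n. if k = i then d k else 0)"
      using i by (intro sum.cong) (auto simp: unit_vec_def)
    also have "\<dots> = d i" using i by simp
    finally show "0 \<le> Re (d i)"
      using psd v cd by (auto simp: pos_semidef_def)
  qed
next
  note cd = udiag_carrier[OF U, of d]
  assume d: "\<forall>i<n. d i \<in> \<real> \<and> 0 \<le> Re (d i)"
  show "pos_semidef (udiag n U d)"
    unfolding pos_semidef_def
  proof (intro conjI ballI)
    show "square_mat (udiag n U d)" using cd by auto
    show "mat_adjoint (udiag n U d) = udiag n U d"
      unfolding udiag_adjoint[OF U]
    proof (rule udiag_eqI[OF U U])
      fix i j assume ij: "i < n" "j < n" "(mat_adjoint U * U) $$ (i, j) \<noteq> 0"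
      then have "i = j" using unitaryD(2)[OF U] by (auto split: if_splits)
      then show "cnj (d i) = d j" using d ij by (simp add: Reals_cnj_iff)
    qed
    fix v :: "complex vec" assume "v \<in> carrier_vec (dim_row (udiag n U d))"
    then have v: "v \<in> carrier_vec n" using cd by simp
    show "0 \<le> Re ((udiag n U d *\<^sub>v v) \<bullet>c v)"
      unfolding udiag_quadratic_form[OF U v] Re_sum
      using d by (intro sum_nonneg) auto
  qed
qed

lemma pos_semidef_udiagE:
  assumes P: "P \<in> carrier_mat n n" and psd: "pos_semidef P"
  obtains U p where "unitary n U" "P = udiag n U p" "\<And>i. i < n \<Longrightarrow> p i \<in> \<real> \<and> 0 \<le> Re (p i)"
proof -
  have "normal_mat P" using psd by (simp add: pos_semidef_def normal_mat_def)
  moreover obtain es where "char_poly P = (\<Prod>e\<leftarrow>es. [:- e, 1:])"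
    using char_poly_factorized[OF P] by blast
  ultimately obtain U where U: "unitary n U" and eq: "P = udiag n U (\<lambda>i. es ! i)"
    using spectral_theorem_normal[OF P] by blast
  show ?thesis
    using that[OF U eq] psd pos_semidef_udiag_iff[OF U] unfolding eq by blast
qed

text \<open>
  Diagonalise \<open>P = U diag(p) U\<^sup>*\<close> and \<open>Q = V diag(q) V\<^sup>*\<close>. The equation \<open>P\<^sup>2 = Q\<^sup>2\<close> says
  that \<open>p\<^sub>i\<^sup>2 = q\<^sub>j\<^sup>2\<close> wherever the \<open>(i, j)\<close> entry of \<open>U\<^sup>* V\<close> is nonzero, hence \<open>p\<^sub>i = q\<^sub>j\<close> there.
\<close>
lemma pos_semidef_sqrt_unique:
  assumes "P \<in> carrier_mat n n" "Q \<in> carrier_mat n n" "pos_semidef P" "pos_semidef Q" "P * P = Q * Q"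
  shows "P = Q"
proof -
  obtain U p where U: "unitary n U" and P: "P = udiag n U p"
    and p: "\<And>i. i < n \<Longrightarrow> p i \<in> \<real> \<and> 0 \<le> Re (p i)"
    using pos_semidef_udiagE[OF assms(1,3)] by metis
  obtain V q where V: "unitary n V" and Q: "Q = udiag n V q"
    and q: "\<And>i. i < n \<Longrightarrow> q i \<in> \<real> \<and> 0 \<le> Re (q i)"
    using pos_semidef_udiagE[OF assms(2,4)] by metis
  have sq: "udiag n U (\<lambda>i. p i * p i) = udiag n V (\<lambda>i. q i * q i)"
    using assms(5) unfolding P Q udiag_mult[OF U] udiag_mult[OF V] .
  show ?thesis
    unfolding P Q
  proof (rule udiag_eqI[OF U V])
    fix i j assume ij: "i < n" "j < n" and nz: "(mat_adjoint U * V) $$ (i, j) \<noteq> 0"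
    have "p i * p i = q j * q j"
      using udiag_index[OF U V sq ij] nz by simp
    moreover obtain x where x: "p i = of_real x" using p[OF ij(1)] by (auto elim: Reals_cases)
    moreover obtain y where y: "q j = of_real y" using q[OF ij(2)] by (auto elim: Reals_cases)
    ultimately have "x * x = y * y" by (metis of_real_eq_iff of_real_mult)
    moreover have "0 \<le> x" "0 \<le> y" using p[OF ij(1)] q[OF ij(2)] x y by auto
    ultimately have "x = y" by (metis power2_eq_square power2_eq_imp_eq)
    then show "p i = q j" using x y by simp
  qed
qed

text \<open>
  The right-hand side is a positive semidefinite square root of \<open>A\<^sup>* A\<close>, so by uniqueness the
  definite description denotes it.
\<close>
lemma mat_abs_udiag:
  assumes U: "unitary n U"
  shows "mat_abs (udiag n U d) = udiag n U (\<lambda>i. of_real (cmod (d i)))"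
    (is "_ = ?R")
proof -
  have R: "?R \<in> carrier_mat n n" by (rule udiag_carrier[OF U])
  have psd: "pos_semidef ?R" by (simp add: pos_semidef_udiag_iff[OF U])
  have AA: "mat_adjoint (udiag n U d) * udiag n U d = ?R * ?R"
    unfolding udiag_adjoint[OF U] udiag_mult[OF U] complex_norm_square[symmetric]
    by (simp add: complex_norm_square[symmetric] mult.commute[of "cnj _"] power2_eq_square)
  show ?thesis
    unfolding mat_abs_def mat_sqrt_def AA
  proof (rule the_equality)
    fix P assume P: "pos_semidef P \<and> P * P = ?R * ?R"
    have "dim_row P = dim_row (P * P)" by simp
    also have "\<dots> = n" using P R by simp
    finally have "P \<in> carrier_mat n n" using P by (auto simp: pos_semidef_def)
    then show "P = ?R" using pos_semidef_sqrt_unique R P psd by blast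
  qed (use psd in blast)
qed

section \<open>Eigenvalue lists padded by zeros\<close>

text \<open>
  Positions count from \<open>0\<close>, whereas the eigenvalue lists are indexed from \<open>1\<close>.
\<close>
definition padded :: "nat \<Rightarrow> (nat \<Rightarrow> complex) \<Rightarrow> nat \<Rightarrow> complex" where
  "padded r lam i = (if i < r then lam (Suc i) else 0)"

lemma order_prod_linear_factors:
  fixes as :: "'a::field list"
  shows "order x (\<Prod>a\<leftarrow>as. [:- a, 1:]) = count (mset as) x"
proof (induction as)
  case (Cons a as)
  have "order x ([:- a, 1:] * (\<Prod>a\<leftarrow>as. [:- a, 1:]))
      = order x [:- a, 1:] + order x (\<Prod>a\<leftarrow>as. [:- a, 1:])"
    by (rule order_mult, simp only: mult_eq_0_iff prod_list_zero_iff) auto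
  moreover have "order x [:- a, 1:] = (if a = x then 1 else 0)"
    using order_power_n_n[of a 1] order_0I[of "[:- a, 1:]" x] by auto
  ultimately show ?case using Cons by simp
qed (simp add: order_1_eq_0)

lemma prod_list_mset_cong:
  fixes f :: "'a \<Rightarrow> 'b::comm_monoid_mult"
  assumes "mset xs = mset ys"
  shows "(\<Prod>x\<leftarrow>xs. f x) = (\<Prod>x\<leftarrow>ys. f x)"
  unfolding prod_mset_prod_list[symmetric] mset_map assms ..

lemma mset_map_padded:
  assumes "r \<le> n"
  shows "mset (map (padded r lam) [0..<n])
    = mset (map lam [1..<Suc r]) + replicate_mset (n - r) 0"
proof -
  have "[0..<n] = [0..<r] @ [r..<n]"
    using assms upt_add_eq_append[of 0 r "n - r"] by simp
  moreover have "map (padded r lam) [0..<r] = map lam [1..<Suc r]"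
    by (rule nth_equalityI) (auto simp: padded_def simp del: upt_Suc)
  moreover have "map (padded r lam) [r..<n] = replicate (n - r) 0"
    by (rule nth_equalityI) (auto simp: padded_def)
  ultimately show ?thesis by (simp del: upt_Suc)
qed

text \<open>
  The prescribed multiplicities fix all nonzero roots of the characteristic polynomial, and its degree
  \<open>n\<close> then fixes the multiplicity of \<open>0\<close>.
\<close>
lemma char_poly_padded:
  assumes A: "A \<in> carrier_mat n n" and ev: "nonzero_eigenvalues A r lam"
  shows "r \<le> n" and "char_poly A = (\<Prod>e\<leftarrow>map (padded r lam) [0..<n]. [:- e, 1:])"
proof -
  obtain as where as: "char_poly A = (\<Prod>a\<leftarrow>as. [:- a, 1:])" and len: "length as = n"
    using char_poly_factorized[OF A] by blast
  let ?L = "map lam [1..<Suc r]"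
  have cL: "count (mset ?L) x = card {j \<in> {1..r}. lam j = x}" for x
  proof -
    have "count (mset ?L) x = length (filter (\<lambda>j. x = lam j) [1..<Suc r])"
      by (simp only: count_mset count_list_eq_length_filter filter_map length_map o_def)
    also have "\<dots> = card ({j. x = lam j} \<inter> set [1..<Suc r])"
      by (rule distinct_length_filter) simp
    also have "{j. x = lam j} \<inter> set [1..<Suc r] = {j \<in> {1..r}. lam j = x}"
      by (auto simp del: upt_Suc)
    finally show ?thesis .
  qed
  have "mset as = mset ?L + replicate_mset (count (mset as) 0) 0"
  proof (rule multiset_eqI)
    fix x
    have "count (mset ?L) 0 = 0"
      unfolding cL using ev by (simp add: nonzero_eigenvalues_def)
    moreover have "count (mset as) x = count (mset ?L) x" if "x \<noteq> 0"
      using that ev unfolding cL by (simp add: nonzero_eigenvalues_def as order_prod_linear_factors)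
    ultimately show "count (mset as) x = count (mset ?L + replicate_mset (count (mset as) 0) 0) x"
      by (cases "x = 0") (simp_all del: upt_Suc)
  qed
  moreover from arg_cong[OF this, of size] have n: "n = r + count (mset as) 0"
    using len by (simp del: upt_Suc)
  ultimately have "mset as = mset (map (padded r lam) [0..<n])"
    by (subst mset_map_padded) (simp_all del: upt_Suc)
  then show "char_poly A = (\<Prod>e\<leftarrow>map (padded r lam) [0..<n]. [:- e, 1:])"
    unfolding as by (rule prod_list_mset_cong)
  show "r \<le> n" using n by simp
qed

lemma normal_with_eigenvalues_udiag:
  assumes "normal_with_eigenvalues n r lam A"
  obtains U where "unitary n U" "A = udiag n U (padded r lam)"
proof -
  have A: "A \<in> carrier_mat n n" and N: "normal_mat A" and ev: "nonzero_eigenvalues A r lam"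
    using assms by (auto simp: normal_with_eigenvalues_def)
  obtain U where U: "unitary n U" "A = udiag n U (\<lambda>i. map (padded r lam) [0..<n] ! i)"
    using spectral_theorem_normal[OF A N char_poly_padded(2)[OF A ev]] by blast
  have "mat_diag n (\<lambda>i. map (padded r lam) [0..<n] ! i) = mat_diag n (padded r lam)"
    by (rule eq_matI) (auto simp: mat_diag_def)
  then show ?thesis using that U by (simp add: udiag_def)
qed

text \<open>
  The nonzero columns are nonzero multiples of distinct unit vectors, and any further column is the zero
  vector, so they form a maximal independent set of columns.
\<close>
lemma rank_mat_diag:
  fixes d :: "nat \<Rightarrow> 'a::field"
  shows "vec_space.rank n (mat_diag n d) = card {i. i < n \<and> d i \<noteq> 0}"
proof -
  interpret vec_space "TYPE('a)" n .
  define c where "c = col (mat_diag n d)"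
  have ci: "c i \<in> carrier_vec n" for i
    unfolding c_def mat_diag_def by (rule carrier_vecI) simp
  have cij: "c i $ j = (if i = j then d i else 0)" if "i < n" "j < n" for i j
    using that by (simp add: c_def mat_diag_def)
  let ?I = "{i. i < n \<and> d i \<noteq> 0}"
  let ?S = "c ` ?I"
  have cols: "set (cols (mat_diag n d)) = c ` {..<n}"
    by (auto simp: cols_def c_def mat_diag_def)
  have inj: "inj_on c ?I"
  proof (rule inj_onI)
    fix i j assume ij: "i \<in> ?I" "j \<in> ?I" and eq: "c i = c j"
    have "c j $ i = d i" using cij[of i i] ij(1) unfolding eq by simp
    moreover have "c j $ i = (if j = i then d j else 0)" using cij ij by blast
    ultimately show "i = j" using ij(1) by (auto split: if_splits)
  qed
  have Sc: "?S \<subseteq> carrier_vec n" using ci by auto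
  have "lin_indpt ?S"
  proof (rule finite_lin_indpt2)
    fix a :: "'a vec \<Rightarrow> 'a" assume "lincomb a ?S = 0\<^sub>v n"
    show "\<forall>v\<in>?S. a v = 0"
    proof
      fix v assume "v \<in> ?S"
      then obtain i where i: "i < n" "d i \<noteq> 0" "v = c i" by auto
      have "0 = lincomb a ?S $ i" using \<open>lincomb a ?S = 0\<^sub>v n\<close> i by simp
      also have "\<dots> = (\<Sum>x\<in>?S. a x * x $ i)" by (rule lincomb_index[OF i(1) Sc])
      also have "\<dots> = (\<Sum>j\<in>?I. a (c j) * c j $ i)" by (simp add: sum.reindex[OF inj])
      also have "\<dots> = (\<Sum>j\<in>?I. if j = i then a v * d i else 0)"
        using i cij by (intro sum.cong) auto
      also have "\<dots> = a v * d i" using i by simp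
      finally show "a v = 0" using i by simp
    qed
  qed (use Sc in auto)
  moreover have "T = ?S" if T: "T \<subseteq> c ` {..<n}" "lin_indpt T" "?S \<subseteq> T" for T
  proof -
    have "T \<subseteq> ?S"
    proof
      fix v assume v: "v \<in> T"
      then obtain i where i: "i < n" "v = c i" using T(1) by auto
      have "v \<noteq> 0\<^sub>v n"
        using vs_zero_lin_dep[of T] T(1,2) ci v by auto
      moreover have "v = 0\<^sub>v n" if "d i = 0"
        using i ci[of i] cij that by (intro eq_vecI) auto
      ultimately have "d i \<noteq> 0" by blast
      then show "v \<in> ?S" using i by auto
    qed
    with T(3) show ?thesis by blast
  qed
  ultimately have "maximal ?S (\<lambda>T. T \<subseteq> set (cols (mat_diag n d)) \<and> lin_indpt T)"
    unfolding maximal_def cols by auto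
  then have "rank (mat_diag n d) = card ?S" by (rule rank_card_indpt[OF mat_diag_dim])
  then show ?thesis by (simp add: card_image[OF inj])
qed

lemma normal_with_eigenvalues_diag:
  assumes A: "normal_with_eigenvalues n r lam A" and \<sigma>: "\<sigma> permutes {..<n}"
  shows "normal_with_eigenvalues n r lam (mat_diag n (\<lambda>i. padded r lam (\<sigma> i)))"
    (is "normal_with_eigenvalues n r lam ?D")
  unfolding normal_with_eigenvalues_def
proof (intro conjI)
  have cA: "A \<in> carrier_mat n n" and ev: "nonzero_eigenvalues A r lam"
    using A by (auto simp: normal_with_eigenvalues_def)
  note rn = char_poly_padded(1)[OF cA ev]
  show "?D \<in> carrier_mat n n" by simp
  show "normal_mat ?D" by (rule normal_matI[of _ n]) (simp_all add: mult.commute)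
  have "i < n \<and> padded r lam (\<sigma> i) \<noteq> 0 \<longleftrightarrow> \<sigma> i < r" for i
  proof -
    have "padded r lam (\<sigma> i) \<noteq> 0 \<longleftrightarrow> \<sigma> i < r"
      using ev by (simp add: padded_def nonzero_eigenvalues_def)
    moreover have "\<sigma> i < n \<longleftrightarrow> i < n" using permutes_in_image[OF \<sigma>, of i] by simp
    ultimately show ?thesis using rn by linarith
  qed
  then have "{i. i < n \<and> padded r lam (\<sigma> i) \<noteq> 0} = {i. \<sigma> i \<in> {..<r}}" by simp
  also have "card \<dots> = r"
    using card_vimage_inj[OF permutes_inj[OF \<sigma>], of "{..<r}"] permutes_surj[OF \<sigma>]
    by (simp add: vimage_def)
  finally show "vec_space.rank n ?D = r" by (simp add: rank_mat_diag)
  have "mset (map (padded r lam) (map \<sigma> [0..<n])) = mset (map (padded r lam) [0..<n])"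
  proof -
    have "image_mset \<sigma> (mset_set {0..<n}) = mset_set (\<sigma> ` {0..<n})"
      using permutes_inj[OF \<sigma>] by (intro image_mset_mset_set) (auto intro: inj_on_subset)
    also have "\<sigma> ` {0..<n} = {0..<n}"
      using permutes_image[OF \<sigma>] by (simp add: atLeast0LessThan)
    finally have "mset (map \<sigma> [0..<n]) = mset [0..<n]" by simp
    then show ?thesis by (simp only: mset_map)
  qed
  then have "(\<Prod>e\<leftarrow>map (padded r lam) (map \<sigma> [0..<n]). [:- e, 1:]) = char_poly A"
    unfolding char_poly_padded(2)[OF cA ev] by (rule prod_list_mset_cong)
  moreover have "char_poly ?D = (\<Prod>e\<leftarrow>diag_mat ?D. [:- e, 1:])"
    by (rule char_poly_upper_triangular[of _ n]) (auto simp: mat_diag_def)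
  moreover have "diag_mat ?D = map (padded r lam) (map \<sigma> [0..<n])"
    by (auto simp: diag_mat_def mat_diag_def)
  ultimately have "char_poly ?D = char_poly A" by simp
  then show "nonzero_eigenvalues ?D r lam" using ev by (simp add: nonzero_eigenvalues_def)
qed

section \<open>Permutations and arrangements\<close>

lemma padded_sum_sq:
  assumes "r \<le> n"
  shows "(\<Sum>i<n. (cmod (padded r lam i))\<^sup>2) = (\<Sum>j=1..r. (cmod (lam j))\<^sup>2)"
proof -
  have "(\<Sum>i<n. (cmod (padded r lam i))\<^sup>2) = (\<Sum>i<r. (cmod (padded r lam i))\<^sup>2)"
    using assms by (intro sum.mono_neutral_right) (auto simp: padded_def)
  also have "\<dots> = (\<Sum>i<r. (cmod (lam (Suc i)))\<^sup>2)"
    by (simp add: padded_def)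
  also have "\<dots> = (\<Sum>j=1..r. (cmod (lam j))\<^sup>2)"
    by (rule sum.reindex_bij_witness[of _ "\<lambda>j. j - 1" Suc]) auto
  finally show ?thesis .
qed

lemma cmod_diff_sq: "(cmod (a - b))\<^sup>2 = (cmod a)\<^sup>2 + (cmod b)\<^sup>2 - 2 * Re (b * cnj a)"
  unfolding cmod_power2 by (simp add: power2_eq_square algebra_simps)

text \<open>
  The squared distances between the diagonal matrices of the padded lists, and between their absolute
  values, the second list being permuted by \<open>\<sigma>\<close>.
\<close>
definition diag_gap :: "nat \<Rightarrow> nat \<Rightarrow> nat \<Rightarrow> (nat \<Rightarrow> complex) \<Rightarrow> (nat \<Rightarrow> complex) \<Rightarrow> (nat \<Rightarrow> nat) \<Rightarrow> real"
  where "diag_gap n r s lam lamh \<sigma> = (\<Sum>i<n. (cmod (padded r lam i - padded s lamh (\<sigma> i)))\<^sup>2)"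

definition diag_abs_gap :: "nat \<Rightarrow> nat \<Rightarrow> nat \<Rightarrow> (nat \<Rightarrow> complex) \<Rightarrow> (nat \<Rightarrow> complex) \<Rightarrow> (nat \<Rightarrow> nat) \<Rightarrow> real"
  where "diag_abs_gap n r s lam lamh \<sigma>
    = (\<Sum>i<n. (cmod (padded r lam i) - cmod (padded s lamh (\<sigma> i)))\<^sup>2)"

text \<open>
  Denominator and numerator of the quotient that an arrangement contributes to the minimum.
\<close>
definition list_gap :: "nat \<Rightarrow> nat \<Rightarrow> (nat \<Rightarrow> complex) \<Rightarrow> (nat \<Rightarrow> complex) \<Rightarrow> nat \<Rightarrow> nat list \<Rightarrow> nat list \<Rightarrow> real"
  where "list_gap r s lam lamh k p q
    = F_hat r s lam lamh - 2 * (\<Sum>t<k. Re (lamh (p ! t) * cnj (lam (q ! t))))"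

definition list_abs_gap :: "nat \<Rightarrow> nat \<Rightarrow> (nat \<Rightarrow> complex) \<Rightarrow> (nat \<Rightarrow> complex) \<Rightarrow> nat \<Rightarrow> nat list \<Rightarrow> nat list \<Rightarrow> real"
  where "list_abs_gap r s lam lamh k p q
    = F_hat r s lam lamh - 2 * (\<Sum>t<k. cmod (lamh (p ! t)) * cmod (lam (q ! t)))"

lemma padded_sum_sq_permuted:
  assumes "s \<le> n" "\<sigma> permutes {..<n}"
  shows "(\<Sum>i<n. (cmod (padded s lamh (\<sigma> i)))\<^sup>2) = (\<Sum>j=1..s. (cmod (lamh j))\<^sup>2)"
proof -
  have "(\<Sum>i<n. (cmod (padded s lamh (\<sigma> i)))\<^sup>2) = (\<Sum>i<n. (cmod (padded s lamh i))\<^sup>2)"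
    using sum.permute[OF assms(2), of "\<lambda>i. (cmod (padded s lamh i))\<^sup>2"] by (simp add: o_def)
  then show ?thesis using padded_sum_sq[OF assms(1)] by simp
qed

lemma diag_gap_expand:
  assumes "r \<le> n" "s \<le> n" "\<sigma> permutes {..<n}"
  shows "diag_gap n r s lam lamh \<sigma>
    = F_hat r s lam lamh - 2 * (\<Sum>i<n. Re (padded s lamh (\<sigma> i) * cnj (padded r lam i)))"
  unfolding diag_gap_def cmod_diff_sq F_hat_def sum_subtractf sum.distrib
    padded_sum_sq[OF assms(1)] padded_sum_sq_permuted[OF assms(2,3)] sum_distrib_left ..

lemma diag_abs_gap_expand:
  assumes "r \<le> n" "s \<le> n" "\<sigma> permutes {..<n}"
  shows "diag_abs_gap n r s lam lamh \<sigma>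
    = F_hat r s lam lamh - 2 * (\<Sum>i<n. cmod (padded s lamh (\<sigma> i)) * cmod (padded r lam i))"
proof -
  have "diag_abs_gap n r s lam lamh \<sigma> = (\<Sum>i<n. (cmod (padded r lam i))\<^sup>2
      + (cmod (padded s lamh (\<sigma> i)))\<^sup>2 - 2 * (cmod (padded s lamh (\<sigma> i)) * cmod (padded r lam i)))"
    unfolding diag_abs_gap_def by (simp add: power2_diff mult_ac)
  then show ?thesis
    unfolding F_hat_def sum_subtractf sum.distrib
      padded_sum_sq[OF assms(1)] padded_sum_sq_permuted[OF assms(2,3)] sum_distrib_left .
qed

text \<open>
  Only positions at which both padded lists are nonzero contribute to the mixed sums, so the corresponding
  index pairs, listed in increasing order of position, are the arrangement.
\<close>
lemma gap_of_permutation: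
  assumes "r \<le> n" "s \<le> n" and \<sigma>: "\<sigma> permutes {..<n}"
  shows "\<exists>k p q. k \<le> r \<and> p \<in> arrangements k {1..s} \<and> q \<in> arrangements k {1..r}
    \<and> diag_gap n r s lam lamh \<sigma> = list_gap r s lam lamh k p q
    \<and> diag_abs_gap n r s lam lamh \<sigma> = list_abs_gap r s lam lamh k p q"
proof -
  define ks where "ks = filter (\<lambda>i. i < r \<and> \<sigma> i < s) [0..<n]"
  let ?q = "map Suc ks" and ?p = "map (\<lambda>i. Suc (\<sigma> i)) ks"
  have ks: "distinct ks" "set ks = {i. i < r \<and> \<sigma> i < s}"
    using assms(1) by (auto simp: ks_def)
  have "length ks = card (set ks)" using ks(1) by (simp add: distinct_card)
  also have "\<dots> \<le> card {..<r}" unfolding ks(2) by (intro card_mono) auto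
  finally have len: "length ks \<le> r" by simp
  have q: "?q \<in> arrangements (length ks) {1..r}"
    unfolding arrangements_def mem_Collect_eq
  proof (intro conjI)
    show "distinct ?q" using ks(1) by (simp add: distinct_map)
    show "set ?q \<subseteq> {1..r}" unfolding set_map ks(2) by auto
  qed simp
  have inj: "inj_on (\<lambda>i. Suc (\<sigma> i)) (set ks)"
    using permutes_inj[OF \<sigma>] by (metis Suc_inject inj_def inj_onI)
  have p: "?p \<in> arrangements (length ks) {1..s}"
    unfolding arrangements_def mem_Collect_eq
  proof (intro conjI)
    show "distinct ?p" using ks(1) inj by (simp add: distinct_map)
    show "set ?p \<subseteq> {1..s}" unfolding set_map ks(2) by auto
  qed simp
  have sum: "(\<Sum>i<n. g (padded s lamh (\<sigma> i)) (padded r lam i))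
      = (\<Sum>t<length ks. g (lamh (?p ! t)) (lam (?q ! t)))"
    if g: "\<And>z. g 0 z = 0" "\<And>z. g z 0 = 0" for g :: "complex \<Rightarrow> complex \<Rightarrow> real"
  proof -
    have "(\<Sum>i<n. g (padded s lamh (\<sigma> i)) (padded r lam i))
        = (\<Sum>i\<in>set ks. g (padded s lamh (\<sigma> i)) (padded r lam i))"
      using ks(2) assms(1) g by (intro sum.mono_neutral_right) (auto simp: padded_def)
    also have "\<dots> = (\<Sum>i\<in>set ks. g (lamh (Suc (\<sigma> i))) (lam (Suc i)))"
      using ks(2) by (intro sum.cong) (auto simp: padded_def)
    also have "\<dots> = (\<Sum>i\<leftarrow>ks. g (lamh (Suc (\<sigma> i))) (lam (Suc i)))"
      using ks(1) by (simp add: sum_list_distinct_conv_sum_set)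
    also have "\<dots> = (\<Sum>t<length ks. g (lamh (?p ! t)) (lam (?q ! t)))"
      by (simp add: sum_list_sum_nth atLeast0LessThan)
    finally show ?thesis .
  qed
  have "diag_gap n r s lam lamh \<sigma> = list_gap r s lam lamh (length ks) ?p ?q"
    unfolding diag_gap_expand[OF assms] list_gap_def
    using sum[of "\<lambda>x y. Re (x * cnj y)"] by simp
  moreover have "diag_abs_gap n r s lam lamh \<sigma> = list_abs_gap r s lam lamh (length ks) ?p ?q"
    unfolding diag_abs_gap_expand[OF assms] list_abs_gap_def
    using sum[of "\<lambda>x y. cmod x * cmod y"] by simp
  ultimately show ?thesis using len p q by blast
qed

text \<open>
  The permutation extends the matching \<open>q ! t \<mapsto> p ! t\<close>. The numbers \<open>x\<close> and \<open>y\<close> are the contributions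
  \<open>|\<mu>||\<lambda>|\<close> and \<open>Re (\<mu> cnj \<lambda>)\<close> of the positions outside that matching.
\<close>
lemma gap_of_arrangement:
  assumes "r \<le> n" "s \<le> n" and p: "p \<in> arrangements k {1..s}" and q: "q \<in> arrangements k {1..r}"
  shows "\<exists>\<sigma> x y. \<sigma> permutes {..<n} \<and> y \<le> x \<and> 0 \<le> x
    \<and> list_gap r s lam lamh k p q = diag_gap n r s lam lamh \<sigma> + 2 * y
    \<and> list_abs_gap r s lam lamh k p q = diag_abs_gap n r s lam lamh \<sigma> + 2 * x"
proof -
  let ?p = "map (\<lambda>j. j - 1) p" and ?q = "map (\<lambda>j. j - 1) q"
  have len: "length p = k" "length q = k" and d: "distinct p" "distinct q"
    and sub: "set p \<subseteq> {1..s}" "set q \<subseteq> {1..r}"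
    using p q by (auto simp: arrangements_def)
  have inj: "inj_on (\<lambda>j. j - 1) {1..m}" for m :: nat by (auto simp: inj_on_def)
  have d': "distinct ?p" "distinct ?q"
    using d inj_on_subset[OF inj sub(1)] inj_on_subset[OF inj sub(2)] by (simp_all add: distinct_map)
  have "set ?p \<subseteq> {..<n}" "set ?q \<subseteq> {..<n}"
    using sub assms(1,2) by fastforce+
  then obtain \<sigma> where \<sigma>: "\<sigma> permutes {..<n}" and ext: "\<And>t. t < k \<Longrightarrow> \<sigma> (?q ! t) = ?p ! t"
    using extend_partial_injection[of "{..<n}" ?q ?p] d' len by auto
  define R where "R = {..<n} - set ?q"
  have sum: "(\<Sum>i<n. g (padded s lamh (\<sigma> i)) (padded r lam i))
      = (\<Sum>t<k. g (lamh (p ! t)) (lam (q ! t)))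
        + (\<Sum>i\<in>R. g (padded s lamh (\<sigma> i)) (padded r lam i))"
    for g :: "complex \<Rightarrow> complex \<Rightarrow> real"
  proof -
    let ?G = "\<lambda>i. g (padded s lamh (\<sigma> i)) (padded r lam i)"
    have "(\<Sum>i<n. ?G i) = (\<Sum>i\<in>set ?q. ?G i) + (\<Sum>i\<in>R. ?G i)"
      unfolding R_def using sum.subset_diff[OF \<open>set ?q \<subseteq> {..<n}\<close> finite_lessThan, of ?G]
      by (simp only: add.commute)
    also have "(\<Sum>i\<in>set ?q. ?G i) = (\<Sum>t<k. ?G (?q ! t))"
      using d'(2) len by (simp add: sum_list_distinct_conv_sum_set[symmetric] sum_list_sum_nth atLeast0LessThan del: set_map)
    also have "\<dots> = (\<Sum>t<k. g (lamh (p ! t)) (lam (q ! t)))"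
    proof (rule sum.cong[OF refl])
      fix t assume "t \<in> {..<k}"
      then have t: "t < k" by simp
      have "p ! t \<in> {1..s}" "q ! t \<in> {1..r}"
        using sub t len by (auto simp: subset_iff)
      then show "?G (?q ! t) = g (lamh (p ! t)) (lam (q ! t))"
        using ext[OF t] t len by (auto simp: padded_def)
    qed
    finally show ?thesis using len by simp
  qed
  let ?x = "\<Sum>i\<in>R. cmod (padded s lamh (\<sigma> i)) * cmod (padded r lam i)"
  let ?y = "\<Sum>i\<in>R. Re (padded s lamh (\<sigma> i) * cnj (padded r lam i))"
  have "?y \<le> ?x"
  proof (rule sum_mono)
    fix i
    show "Re (padded s lamh (\<sigma> i) * cnj (padded r lam i))
        \<le> cmod (padded s lamh (\<sigma> i)) * cmod (padded r lam i)"
      using complex_Re_le_cmod[of "padded s lamh (\<sigma> i) * cnj (padded r lam i)"] by (simp add: norm_mult)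
  qed
  moreover have "0 \<le> ?x" by (intro sum_nonneg) simp
  moreover have "list_gap r s lam lamh k p q = diag_gap n r s lam lamh \<sigma> + 2 * ?y"
    unfolding diag_gap_expand[OF assms(1,2) \<sigma>] list_gap_def
    using sum[of "\<lambda>x y. Re (x * cnj y)"] by simp
  moreover have "list_abs_gap r s lam lamh k p q = diag_abs_gap n r s lam lamh \<sigma> + 2 * ?x"
    unfolding diag_abs_gap_expand[OF assms(1,2) \<sigma>] list_abs_gap_def
    using sum[of "\<lambda>x y. cmod x * cmod y"] by simp
  ultimately show ?thesis using \<sigma> by blast
qed

lemma diag_abs_gap_nonneg: "0 \<le> diag_abs_gap n r s lam lamh \<sigma>"
  unfolding diag_abs_gap_def by (intro sum_nonneg) simp

text \<open>
  By \<open>gap_of_arrangement\<close> with \<open>n = s\<close> the quantity is a sum of squares plus a nonnegative number.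
\<close>
lemma list_abs_gap_nonneg:
  assumes "r \<le> s" "p \<in> arrangements k {1..s}" "q \<in> arrangements k {1..r}"
  shows "0 \<le> list_abs_gap r s lam lamh k p q"
proof -
  obtain \<sigma> x where "0 \<le> x" "list_abs_gap r s lam lamh k p q = diag_abs_gap s r s lam lamh \<sigma> + 2 * x"
    using gap_of_arrangement[OF assms(1) order_refl assms(2,3)] by blast
  then show ?thesis using diag_abs_gap_nonneg[of s r s lam lamh \<sigma>] by simp
qed

lemma list_abs_gap_le_list_gap: "list_abs_gap r s lam lamh k p q \<le> list_gap r s lam lamh k p q"
proof -
  have "Re (a * cnj b) \<le> cmod a * cmod b" for a b
    using complex_Re_le_cmod[of "a * cnj b"] by (simp add: norm_mult)
  then have "(\<Sum>t<k. Re (lamh (p ! t) * cnj (lam (q ! t))))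
      \<le> (\<Sum>t<k. cmod (lamh (p ! t)) * cmod (lam (q ! t)))"
    by (intro sum_mono)
  then show ?thesis unfolding list_abs_gap_def list_gap_def by linarith
qed

lemma quot_bounds:
  assumes "0 \<le> a" "a \<le> b"
  shows "0 \<le> quot a b" "quot a b \<le> 1"
  using assms by (auto simp: quot_def divide_le_eq_1)

definition coeff_set :: "nat \<Rightarrow> nat \<Rightarrow> (nat \<Rightarrow> complex) \<Rightarrow> (nat \<Rightarrow> complex) \<Rightarrow> real set" where
  "coeff_set r s lam lamh = {sqrt (quot (list_abs_gap r s lam lamh k p q) (list_gap r s lam lamh k p q))
          | k p q. 1 \<le> k \<and> k \<le> r \<and> p \<in> arrangements k {1..s} \<and> q \<in> arrangements k {1..r}}"

lemma abs_coeff_Min: "abs_coeff r s lam lamh = Min (coeff_set r s lam lamh)"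
  unfolding abs_coeff_def coeff_set_def list_abs_gap_def list_gap_def ..

lemma finite_coeff_set: "finite (coeff_set r s lam lamh)"
proof (rule finite_subset)
  let ?L = "\<lambda>m::nat. {xs. set xs \<subseteq> {1..m} \<and> length xs \<le> r}"
  show "coeff_set r s lam lamh \<subseteq> (\<lambda>(k, p, q). sqrt (quot (list_abs_gap r s lam lamh k p q)
      (list_gap r s lam lamh k p q))) ` ({..r} \<times> ?L s \<times> ?L r)"
  proof
    fix z assume "z \<in> coeff_set r s lam lamh"
    then obtain k p q where "k \<le> r" "p \<in> arrangements k {1..s}" "q \<in> arrangements k {1..r}"
      and "z = sqrt (quot (list_abs_gap r s lam lamh k p q) (list_gap r s lam lamh k p q))"
      unfolding coeff_set_def by blast
    then show "z \<in> (\<lambda>(k, p, q). sqrt (quot (list_abs_gap r s lam lamh k p q)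
        (list_gap r s lam lamh k p q))) ` ({..r} \<times> ?L s \<times> ?L r)"
      by (intro rev_image_eqI[of "(k, p, q)"]) (simp_all add: arrangements_def)
  qed
  show "finite ((\<lambda>(k, p, q). sqrt (quot (list_abs_gap r s lam lamh k p q)
      (list_gap r s lam lamh k p q))) ` ({..r} \<times> ?L s \<times> ?L r))"
    by (intro finite_imageI finite_cartesian_product finite_lists_length_le) auto
qed

lemma coeff_set_nonempty:
  assumes "1 \<le> r" "r \<le> s"
  shows "coeff_set r s lam lamh \<noteq> {}"
proof -
  have "[1] \<in> arrangements 1 {1..s}" "[1] \<in> arrangements 1 {1..r}"
    using assms by (auto simp: arrangements_def)
  then show ?thesis using assms unfolding coeff_set_def by blast
qed

lemma abs_coeff_attained:
  assumes "1 \<le> r" "r \<le> s"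
  obtains k p q where "1 \<le> k" "k \<le> r" "p \<in> arrangements k {1..s}" "q \<in> arrangements k {1..r}"
    "abs_coeff r s lam lamh = sqrt (quot (list_abs_gap r s lam lamh k p q) (list_gap r s lam lamh k p q))"
proof -
  have "abs_coeff r s lam lamh \<in> coeff_set r s lam lamh"
    unfolding abs_coeff_Min by (rule Min_in[OF finite_coeff_set coeff_set_nonempty[OF assms]])
  then show ?thesis using that unfolding coeff_set_def by blast
qed

lemma abs_coeff_bounds:
  assumes "1 \<le> r" "r \<le> s"
  shows "0 \<le> abs_coeff r s lam lamh" "abs_coeff r s lam lamh \<le> 1"
proof -
  obtain k p q where pq: "p \<in> arrangements k {1..s}" "q \<in> arrangements k {1..r}"
    and c: "abs_coeff r s lam lamh = sqrt (quot (list_abs_gap r s lam lamh k p q) (list_gap r s lam lamh k p q))"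
    using abs_coeff_attained[OF assms] by metis
  note b = quot_bounds[OF list_abs_gap_nonneg[OF assms(2) pq] list_abs_gap_le_list_gap]
  show "0 \<le> abs_coeff r s lam lamh" "abs_coeff r s lam lamh \<le> 1"
    using b by (simp_all add: c)
qed

text \<open>
  The inequality on permutation matrices: each permutation belongs to an arrangement competing in the
  minimum, or to the empty arrangement, where both gaps agree and \<open>c \<le> 1\<close> suffices.
\<close>
lemma abs_coeff_diag:
  assumes rs: "1 \<le> r" "r \<le> s" and n: "s \<le> n" and \<sigma>: "\<sigma> permutes {..<n}"
  shows "(abs_coeff r s lam lamh)\<^sup>2 * diag_gap n r s lam lamh \<sigma> \<le> diag_abs_gap n r s lam lamh \<sigma>"
proof -
  let ?c = "abs_coeff r s lam lamh"
  obtain k p q where k: "k \<le> r" and pq: "p \<in> arrangements k {1..s}" "q \<in> arrangements k {1..r}"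
    and D: "diag_gap n r s lam lamh \<sigma> = list_gap r s lam lamh k p q"
    and N: "diag_abs_gap n r s lam lamh \<sigma> = list_abs_gap r s lam lamh k p q"
    using gap_of_permutation[of r n s \<sigma> lam lamh] rs n \<sigma> by auto
  have N0: "0 \<le> list_abs_gap r s lam lamh k p q" and ND: "list_abs_gap r s lam lamh k p q \<le> list_gap r s lam lamh k p q"
    using list_abs_gap_nonneg[OF rs(2) pq] list_abs_gap_le_list_gap by auto
  note c = abs_coeff_bounds[OF rs, of lam lamh]
  show ?thesis
  proof (cases "k = 0")
    case True
    then have "list_abs_gap r s lam lamh k p q = list_gap r s lam lamh k p q"
      using pq by (simp add: arrangements_def list_abs_gap_def list_gap_def)
    moreover have "?c\<^sup>2 \<le> 1" using c by (simp add: power_le_one)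
    ultimately show ?thesis
      using N0 unfolding D N by (metis mult_right_mono mult_1)
  next
    case False
    then have "1 \<le> k" by simp
    then have "sqrt (quot (list_abs_gap r s lam lamh k p q) (list_gap r s lam lamh k p q)) \<in> coeff_set r s lam lamh"
      using k pq unfolding coeff_set_def by blast
    then have "?c \<le> sqrt (quot (list_abs_gap r s lam lamh k p q) (list_gap r s lam lamh k p q))"
      unfolding abs_coeff_Min by (rule Min_le[OF finite_coeff_set])
    then have c2: "?c\<^sup>2 \<le> quot (list_abs_gap r s lam lamh k p q) (list_gap r s lam lamh k p q)"
      using c(1) quot_bounds(1)[OF N0 ND] by (metis power_mono real_sqrt_pow2)
    show ?thesis
    proof (cases "list_gap r s lam lamh k p q = 0")
      case True
      then show ?thesis using N0 by (simp add: D N)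
    next
      case False
      then have "0 < list_gap r s lam lamh k p q" using N0 ND by linarith
      then show ?thesis using c2 by (simp add: D N quot_def pos_le_divide_eq)
    qed
  qed
qed

text \<open>
  Extending an optimal arrangement replaces its quotient \<open>N / D \<le> 1\<close> by \<open>(N - 2x) / (D - 2y)\<close>
  with \<open>x \<ge> 0\<close> and \<open>x \<ge> y\<close>, which is no larger since \<open>N y \<le> D x\<close>. If \<open>D - 2y = 0\<close>, then
  \<open>N \<le> D = 2y \<le> 2x \<le> N\<close>, so \<open>N = D\<close>.
\<close>
lemma abs_coeff_witness_permutation:
  assumes rs: "1 \<le> r" "r \<le> s" and n: "s \<le> n"
  obtains \<sigma> where "\<sigma> permutes {..<n}"
    "diag_abs_gap n r s lam lamh \<sigma> \<le> (abs_coeff r s lam lamh)\<^sup>2 * diag_gap n r s lam lamh \<sigma>"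
    "diag_gap n r s lam lamh \<sigma> = 0 \<Longrightarrow> abs_coeff r s lam lamh = 1"
proof -
  obtain k p q where pq: "p \<in> arrangements k {1..s}" "q \<in> arrangements k {1..r}"
    and c: "abs_coeff r s lam lamh = sqrt (quot (list_abs_gap r s lam lamh k p q) (list_gap r s lam lamh k p q))"
    using abs_coeff_attained[OF rs] by metis
  obtain \<sigma> x y where \<sigma>: "\<sigma> permutes {..<n}" and xy: "y \<le> x" "0 \<le> x"
    and D: "list_gap r s lam lamh k p q = diag_gap n r s lam lamh \<sigma> + 2 * y"
    and N: "list_abs_gap r s lam lamh k p q = diag_abs_gap n r s lam lamh \<sigma> + 2 * x"
    using gap_of_arrangement[of r n s p k q lam lamh] pq rs n by auto
  let ?D = "list_gap r s lam lamh k p q" and ?N = "list_abs_gap r s lam lamh k p q"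
  have N0: "0 \<le> ?N" and ND: "?N \<le> ?D"
    using list_abs_gap_nonneg[OF rs(2) pq] list_abs_gap_le_list_gap by auto
  note d0 = diag_abs_gap_nonneg[of n r s lam lamh \<sigma>]
  have c2: "(abs_coeff r s lam lamh)\<^sup>2 = quot ?N ?D"
    unfolding c using quot_bounds(1)[OF N0 ND] by simp
  have "diag_abs_gap n r s lam lamh \<sigma> \<le> quot ?N ?D * diag_gap n r s lam lamh \<sigma>"
  proof (cases "?D = 0")
    case True
    then have "?N = 0" using N0 ND by simp
    then have "diag_abs_gap n r s lam lamh \<sigma> = 0" using N xy d0 by linarith
    moreover have "0 \<le> diag_gap n r s lam lamh \<sigma>"
      unfolding diag_gap_def by (intro sum_nonneg) simp
    ultimately show ?thesis using quot_bounds(1)[OF N0 ND] by simp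
  next
    case False
    then have D0: "0 < ?D" using N0 ND by linarith
    \<comment> \<open>This is the claim after clearing denominators.\<close>
    have "?N * y \<le> ?D * x"
    proof (cases "0 \<le> y")
      case True
      then show ?thesis using ND xy D0 by (intro mult_mono) auto
    next
      case False
      then show ?thesis using N0 D0 xy by (smt (verit) mult_nonneg_nonneg mult_nonneg_nonpos)
    qed
    then have "(?N - 2 * x) * ?D \<le> ?N * (?D - 2 * y)" by (simp add: algebra_simps)
    then have "?N - 2 * x \<le> ?N / ?D * (?D - 2 * y)"
      using D0 by (simp add: field_simps)
    then show ?thesis using D0 N D by (simp add: quot_def)
  qed
  moreover have "abs_coeff r s lam lamh = 1" if "diag_gap n r s lam lamh \<sigma> = 0"
  proof -
    have "?N = ?D" using that D N xy ND d0 by linarith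
    then show ?thesis unfolding c by (simp add: quot_def)
  qed
  ultimately show ?thesis using that \<sigma> c2 by simp
qed

section \<open>The inequality and its optimality\<close>

lemma frob_sq_mat_abs_diff:
  assumes U: "unitary n U" and V: "unitary n V"
  shows "frob_sq (mat_abs (udiag n U d) - mat_abs (udiag n V e))
    = (\<Sum>i<n. \<Sum>j<n. (cmod ((mat_adjoint U * V) $$ (i, j)))\<^sup>2 * (cmod (d i) - cmod (e j))\<^sup>2)"
proof -
  have "cmod (of_real a - of_real b) = \<bar>a - b\<bar>" for a b :: real
    by (metis norm_of_real of_real_diff)
  then show ?thesis
    unfolding mat_abs_udiag[OF U] mat_abs_udiag[OF V] frob_sq_udiag_diff[OF U V] by simp
qed

lemma frob_sq_nonneg: "0 \<le> frob_sq A"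
  unfolding frob_sq_def by (intro sum_nonneg) simp

lemma frob_norm_mat_abs_diff_le:
  assumes A: "normal_with_eigenvalues n r lam A" and B: "normal_with_eigenvalues n s lamh B"
  shows "frob_norm (mat_abs A - mat_abs B) \<le> frob_norm (A - B)"
proof -
  obtain U where U: "unitary n U" and A_eq: "A = udiag n U (padded r lam)"
    using normal_with_eigenvalues_udiag[OF A] .
  obtain V where V: "unitary n V" and B_eq: "B = udiag n V (padded s lamh)"
    using normal_with_eigenvalues_udiag[OF B] .
  have "(cmod a - cmod b)\<^sup>2 \<le> (cmod (a - b))\<^sup>2" for a b
    using norm_triangle_ineq3[of a b] by (metis abs_le_square_iff abs_norm_cancel)
  then show ?thesis
    unfolding frob_norm_eq_sqrt A_eq B_eq frob_sq_mat_abs_diff[OF U V] frob_sq_udiag_diff[OF U V]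
    by (intro real_sqrt_le_mono sum_mono mult_left_mono) simp_all
qed

text \<open>
  After squaring both sides, their difference is linear in the doubly stochastic matrix \<open>|X\<^sub>i\<^sub>j|\<^sup>2\<close>, so
  \<open>birkhoff_nonneg\<close> reduces it to \<open>abs_coeff_diag\<close>.
\<close>
lemma abs_coeff_bound:
  assumes rs: "1 \<le> r" "r \<le> s"
    and A: "normal_with_eigenvalues n r lam A" and B: "normal_with_eigenvalues n s lamh B"
  shows "abs_coeff r s lam lamh * frob_norm (A - B) \<le> frob_norm (mat_abs A - mat_abs B)"
proof -
  let ?c = "abs_coeff r s lam lamh" and ?d = "padded r lam" and ?e = "padded s lamh"
  obtain U where U: "unitary n U" and A_eq: "A = udiag n U ?d"
    using normal_with_eigenvalues_udiag[OF A] .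
  obtain V where V: "unitary n V" and B_eq: "B = udiag n V ?e"
    using normal_with_eigenvalues_udiag[OF B] .
  have n: "s \<le> n" using B char_poly_padded(1) by (auto simp: normal_with_eigenvalues_def)
  let ?X = "mat_adjoint U * V"
  have X: "unitary n ?X" by (rule unitary_mult[OF unitary_adjoint[OF U] V])
  let ?C = "\<lambda>i j. (cmod (?d i) - cmod (?e j))\<^sup>2 - ?c\<^sup>2 * (cmod (?d i - ?e j))\<^sup>2"
  let ?S = "\<lambda>i j. (cmod (?X $$ (i, j)))\<^sup>2"
  have "0 \<le> (\<Sum>i<n. \<Sum>j<n. ?S i j * ?C i j)"
  proof (rule birkhoff_nonneg[where t = 1])
    fix \<sigma> assume \<sigma>: "\<sigma> permutes {..<n}"
    show "0 \<le> (\<Sum>i<n. ?C i (\<sigma> i))"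
      using abs_coeff_diag[OF rs n \<sigma>, of lam lamh]
      by (simp add: diag_gap_def diag_abs_gap_def sum_subtractf sum_distrib_left)
  qed (use unitary_row_sum[OF X] unitary_col_sum[OF X] in auto)
  also have "\<dots> = frob_sq (mat_abs A - mat_abs B) - ?c\<^sup>2 * frob_sq (A - B)"
    unfolding A_eq B_eq frob_sq_mat_abs_diff[OF U V] frob_sq_udiag_diff[OF U V]
      sum_distrib_left sum_subtractf[symmetric]
    by (intro sum.cong refl) (simp add: algebra_simps)
  finally have "sqrt (?c\<^sup>2 * frob_sq (A - B)) \<le> sqrt (frob_sq (mat_abs A - mat_abs B))"
    by simp
  then show ?thesis
    using abs_coeff_bounds(1)[OF rs, of lam lamh] by (simp add: frob_norm_eq_sqrt real_sqrt_mult)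
qed

lemma frob_norm_mat_diag_diff:
  "frob_norm (mat_diag n f - mat_diag n g) = sqrt (\<Sum>i<n. (cmod (f i - g i))\<^sup>2)"
proof -
  have "frob_sq (mat_diag n f - mat_diag n g)
      = (\<Sum>i<n. \<Sum>j<n. if j = i then (cmod (f i - g i))\<^sup>2 else 0)"
    unfolding frob_sq_def by (intro sum.cong) (auto simp: mat_diag_def)
  then show ?thesis by (simp add: frob_norm_eq_sqrt)
qed

lemma mat_abs_mat_diag: "mat_abs (mat_diag n f) = mat_diag n (\<lambda>i. of_real (cmod (f i)))"
proof -
  have "udiag n (1\<^sub>m n) g = mat_diag n g" for g
    unfolding udiag_def
    by (simp add: left_mult_one_mat[OF mat_diag_dim] right_mult_one_mat[OF mat_diag_dim])
  then show ?thesis using mat_abs_udiag[OF unitary_one, of n f] by simp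
qed

text \<open>
  The diagonal matrices of \<open>abs_coeff_witness_permutation\<close> refute \<open>c\<close>, unless they coincide; then the
  coefficient is \<open>1\<close> and the given pair \<open>A0 \<noteq> B0\<close> does.
\<close>
lemma abs_coeff_optimal:
  assumes rs: "1 \<le> r" "r \<le> s"
    and A0: "normal_with_eigenvalues n r lam A0" and B0: "normal_with_eigenvalues n s lamh B0"
    and ne: "A0 \<noteq> B0" and c: "abs_coeff r s lam lamh < c"
  shows "\<exists>A B. normal_with_eigenvalues n r lam A \<and> normal_with_eigenvalues n s lamh B \<and> A \<noteq> B
    \<and> frob_norm (mat_abs A - mat_abs B) < c * frob_norm (A - B)"
proof -
  have n: "s \<le> n" using B0 char_poly_padded(1) by (auto simp: normal_with_eigenvalues_def)
  obtain \<sigma> where \<sigma>: "\<sigma> permutes {..<n}"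
    and le: "diag_abs_gap n r s lam lamh \<sigma> \<le> (abs_coeff r s lam lamh)\<^sup>2 * diag_gap n r s lam lamh \<sigma>"
    and zero: "diag_gap n r s lam lamh \<sigma> = 0 \<Longrightarrow> abs_coeff r s lam lamh = 1"
    using abs_coeff_witness_permutation[OF rs n, of lam lamh] by metis
  show ?thesis
  proof (cases "diag_gap n r s lam lamh \<sigma> = 0")
    case True
    have "frob_sq (A0 - B0) \<noteq> 0"
      using ne A0 B0 frob_sq_eq_0 by (auto simp: normal_with_eigenvalues_def)
    then have pos: "0 < frob_norm (A0 - B0)"
      using frob_sq_nonneg[of "A0 - B0"] by (simp add: frob_norm_eq_sqrt)
    have "frob_norm (mat_abs A0 - mat_abs B0) \<le> 1 * frob_norm (A0 - B0)"
      using frob_norm_mat_abs_diff_le[OF A0 B0] by simp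
    also have "\<dots> < c * frob_norm (A0 - B0)"
      using pos c zero[OF True] by (intro mult_strict_right_mono) auto
    finally show ?thesis using A0 B0 ne by blast
  next
    case False
    let ?A = "mat_diag n (padded r lam)" and ?B = "mat_diag n (\<lambda>i. padded s lamh (\<sigma> i))"
    have A: "normal_with_eigenvalues n r lam ?A"
      using normal_with_eigenvalues_diag[OF A0 permutes_id] by simp
    have B: "normal_with_eigenvalues n s lamh ?B"
      by (rule normal_with_eigenvalues_diag[OF B0 \<sigma>])
    have AB: "frob_norm (?A - ?B) = sqrt (diag_gap n r s lam lamh \<sigma>)"
      by (simp add: frob_norm_mat_diag_diff diag_gap_def)
    have "cmod (of_real a - of_real b) = \<bar>a - b\<bar>" for a b :: real
      by (metis norm_of_real of_real_diff)
    then have abs: "frob_norm (mat_abs ?A - mat_abs ?B) = sqrt (diag_abs_gap n r s lam lamh \<sigma>)"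
      by (simp add: mat_abs_mat_diag frob_norm_mat_diag_diff diag_abs_gap_def)
    have "0 \<le> diag_gap n r s lam lamh \<sigma>"
      unfolding diag_gap_def by (intro sum_nonneg) simp
    then have pos: "0 < frob_norm (?A - ?B)" unfolding AB using False by simp
    have "frob_norm (mat_abs ?A - mat_abs ?B)
        \<le> sqrt ((abs_coeff r s lam lamh)\<^sup>2 * diag_gap n r s lam lamh \<sigma>)"
      unfolding abs using le by simp
    also have "\<dots> = abs_coeff r s lam lamh * frob_norm (?A - ?B)"
      unfolding AB using abs_coeff_bounds(1)[OF rs, of lam lamh] by (simp add: real_sqrt_mult)
    also have "\<dots> < c * frob_norm (?A - ?B)"
      using pos c by (intro mult_strict_right_mono)
    finally have "frob_norm (mat_abs ?A - mat_abs ?B) < c * frob_norm (?A - ?B)" .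
    moreover have "?A \<noteq> ?B"
    proof
      assume "?A = ?B"
      then have "frob_sq (?A - ?B) = 0" by (subst frob_sq_eq_0[of _ n]) simp_all
      with pos show False by (simp add: frob_norm_eq_sqrt)
    qed
    ultimately show ?thesis using A B by blast
  qed
qed

theorem theorem1p24:
  fixes n r s :: nat and lam lamh :: "nat \<Rightarrow> complex"
  assumes "1 \<le> r" and "r \<le> s"
  shows "(\<forall>A B. normal_with_eigenvalues n r lam A \<and> normal_with_eigenvalues n s lamh B \<longrightarrow>
            frob_norm (mat_abs A - mat_abs B) \<ge> abs_coeff r s lam lamh * frob_norm (A - B))
       \<and> (s \<le> n \<and> (\<forall>j \<in> {1..r}. lam j \<noteq> 0) \<and> (\<forall>j \<in> {1..s}. lamh j \<noteq> 0) \<and>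
          (\<exists>A B. normal_with_eigenvalues n r lam A \<and> normal_with_eigenvalues n s lamh B \<and> A \<noteq> B)
          \<longrightarrow> (\<forall>c > abs_coeff r s lam lamh.
                \<not> (\<forall>A B. normal_with_eigenvalues n r lam A \<and> normal_with_eigenvalues n s lamh B \<and> A \<noteq> B \<longrightarrow>
                     frob_norm (mat_abs A - mat_abs B) \<ge> c * frob_norm (A - B))))"
proof (intro conjI allI impI)
  fix A B
  assume "normal_with_eigenvalues n r lam A \<and> normal_with_eigenvalues n s lamh B"
  then show "abs_coeff r s lam lamh * frob_norm (A - B) \<le> frob_norm (mat_abs A - mat_abs B)"
    using abs_coeff_bound[OF assms] by blast
next
  fix c
  assume "s \<le> n \<and> (\<forall>j \<in> {1..r}. lam j \<noteq> 0) \<and> (\<forall>j \<in> {1..s}. lamh j \<noteq> 0) \<and>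
      (\<exists>A B. normal_with_eigenvalues n r lam A \<and> normal_with_eigenvalues n s lamh B \<and> A \<noteq> B)"
    and "abs_coeff r s lam lamh < c"
  then obtain A B where "normal_with_eigenvalues n r lam A" "normal_with_eigenvalues n s lamh B"
    "A \<noteq> B" "frob_norm (mat_abs A - mat_abs B) < c * frob_norm (A - B)"
    using abs_coeff_optimal[OF assms] by blast
  then show "\<not> (\<forall>A B. normal_with_eigenvalues n r lam A \<and> normal_with_eigenvalues n s lamh B \<and> A \<noteq> B \<longrightarrow>
      c * frob_norm (A - B) \<le> frob_norm (mat_abs A - mat_abs B))"
    by (meson not_le)
qed

end
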